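(* Let $U$ be a chain of ideals of height $\xi\in\{1,2,3,\ldots,\omega\}$, with $\mathscr J=\mathscr D$-classes $D_0<D_1<\cdots$ (indexed by $0\le q<\xi$) and ideals $I_r=D_0\cup\cdots\cup D_r$ ($0\le r<\xi$), and $I_\omega=U$ if $\xi=\omega$. For each $0\le q<\xi$ let $G_q$ be a group $\mathscr H$-class contained in $D_q$. Suppose there exists $0\le k<\xi$ such that: - every congruence on $I_k$ is liftable to $U$ (i.e. $\operatorname{Cong}^U(I_k)=\operatorname{Cong}(I_k)$), - $\nabla\mathsf{gen}(I_k)$ holds, - $\mathsf{Sep}(I_r)$ holds for all $k<r<\xi$. Then for any $r\ge k$ (i.e. $k\le r<\xi$, and also $r=\omega$ if $\xi=\omega$), $$\operatorname{Cong}(I_r)=\{\sigma\cup\Delta_{I_r}:\sigma\in\operatorname{Cong}(I_k)\}\cup\{R^{I_r}_{I_q,N}: k\le q<r,\ N\unlhd G_{q+1}\}\cup\{\widetilde\nabla_{I_r}\}.$$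
   Context: **Partial semigroups.** A partial semigroup is a 5-tuple $(S,\mathscr C,\mathbf d,\mathbf r,\cdot)$ where $S$ (morphisms) and $\mathscr C$ (objects) are sets, $\mathbf d,\mathbf r:S\to\mathscr C$ are maps, and $\cdot$ is a partial binary operation on $S$ such that $xy$ is defined iff $\mathbf r(x)=\mathbf d(y)$, in which case $\mathbf d(xy)=\mathbf d(x)$ and $\mathbf r(xy)=\mathbf r(y)$, and $(xy)z=x(yz)$ whenever $xy$ and $yz$ are defined. $S^1$ is the category obtained from $S$ by adjoining identities at objects where needed. Write $x\sim y$ if $\mathbf d(x)=\mathbf d(y)$ and $\mathbf r(x)=\mathbf r(y)$. An ideal is a non-empty subset $I\subseteq S$ containing all defined products $sx$, $xs$ with $x\in I$, $s\in S$; it is itself a partial semigroup. An element $x$ is regular if $x=xax$ for some $a\in S$; $S$ is regular if all its elements are. Green's relations: $x\mathrel{\mathscr R}y\Leftrightarrow xS^1=yS^1$, $x\mathrel{\mathscr L}y\Leftrightarrow S^1x=S^1y$, $x\mathrel{\mathscr J}y\Leftrightarrow S^1xS^1=S^1yS^1$, $\mathscr H=\mathscr R\cap\mathscr L$, $\mathscr D=\mathscr R\vee\mathscr L$; $\mathscr J$-classes are ordered by $J_x\le J_y\Leftrightarrow x\in S^1yS^1$. $H_x^S$ is the $\mathscr H$-class of $x$ in $S$. A $\mathscr J$-class $J$ is stable if for all $x\in J$, $a\in S$: $(x,xa)\in\mathscr J\Rightarrow(x,xa)\in\mathscr R$ and $(x,ax)\in\mathscr J\Rightarrow(x,ax)\in\mathscr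 L$ (when the products are defined); $S$ is stable if all its $\mathscr J$-classes are. **Chain of ideals.** A chain of ideals of height $\xi$ is a stable, regular partial semigroup $U$ whose $\mathscr J=\mathscr D$-classes form a chain $D_0<D_1<\cdots$ of order type $\xi$. Green's relations on the ideals $I_r$ are the restrictions of those on $U$. **Congruences.** A congruence on $S$ is an equivalence $\sigma$ such that $(x,y)\in\sigma$ implies $x\sim y$, and $(ax,ay)\in\sigma$ whenever $\mathbf r(a)=\mathbf d(x)$, and $(xa,ya)\in\sigma$ whenever $\mathbf d(a)=\mathbf r(x)$. $\operatorname{Cong}(S)$ is the lattice of congruences. $(x,y)^\sharp_S$ is the congruence on $S$ generated by $(x,y)$. $\Delta_X$ is the equality relation on $X$; $\widetilde\nabla_S=\{(x,y)\in S\times S:x\sim y\}$. For an ideal $I$, $R_I^S=\widetilde\nabla_I\cup\Delta_S$. If $N$ is a normal subgroup of a group $\mathscr H$-class contained in a stable regular $\mathscr J$-class $D$ of $S$, then $\nu_N=\{(axb,ayb): x,y\in N,\ a,b\in S^1,\ axb,ayb\in D\}$; if moreover $D$ is minimal among the $\mathscr J$-classes contained in $S\setminus I$, then $R^S_{I,N}=R_I^S\cup\nu_N$. If $T$ has an ideal $S$, a congruence $\sigma$ on $S$ is liftable to $T$ if $\sigma\cup\Delta_T$ is a congruence on $T$. **Properties.** $\mathcal D\mathsf{max}(T)$: $T$ has a maximum $\mathscr J$-class, and it is regular and stable; it is denoted $D_T$. $\nabla\mathsf{gen}(T)$: $\mathcal D\mathsf{max}(T)$ holds and for any $x\in D_T$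 and $y\in T\setminus H_x^T$ with $x\sim y$ we have $(x,y)^\sharp_T=\widetilde\nabla_T$. $\mathsf{Sep}(T)$: $\mathcal D\mathsf{max}(T)$ holds, the ideal $S=T\setminus D_T$ satisfies $\mathcal D\mathsf{max}(S)$, and: (S1) for $x\in D_T$, $y\in S$ with $x\sim y$ there is $(x',y')\in(x,y)^\sharp_T$ with $x'\in D_S$, $y'\in S\setminus H^S_{x'}$; (S2) for $x\in D_T$, $y\in D_T\setminus H_x^T$ with $x\sim y$ there is $(x',y')\in(x,y)^\sharp_T$ with $x'\in D_T$, $y'\in S$; (S3) for $x\in D_T$, $y\in H_x^T\setminus\{x\}$ there is $(x',y')\in(x,y)^\sharp_T$ with $x'\in D_S$, $y'\in S\setminus H^S_{x'}$. *)

theory Defs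
  imports "HOL-Algebra.Coset" "HOL-Library.Extended_Nat"
begin

text \<open>
  The partial product is a total HOL function that is meaningful only on composable pairs
  of morphisms, i.e. when \<open>pcod S x = pdom S y\<close>; all uses below are guarded accordingly.
\<close>

record ('a, 'o) psgp =
  pmor  :: "'a set"
  pobj  :: "'o set"
  pdom  :: "'a \<Rightarrow> 'o"
  pcod  :: "'a \<Rightarrow> 'o"
  pmult :: "'a \<Rightarrow> 'a \<Rightarrow> 'a"

definition partial_semigroup :: "('a, 'o) psgp \<Rightarrow> bool" where
  "partial_semigroup S \<longleftrightarrow>
     (\<forall>x \<in> pmor S. pdom S x \<in> pobj S \<and> pcod S x \<in> pobj S) \<and>
     (\<forall>x \<in> pmor S. \<forall>y \<in> pmor S. pcod S x = pdom S y \<longrightarrow>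
        pmult S x y \<in> pmor S \<and> pdom S (pmult S x y) = pdom S x \<and> pcod S (pmult S x y) = pcod S y) \<and>
     (\<forall>x \<in> pmor S. \<forall>y \<in> pmor S. \<forall>z \<in> pmor S. pcod S x = pdom S y \<and> pcod S y = pdom S z \<longrightarrow>
        pmult S (pmult S x y) z = pmult S x (pmult S y z))"

definition psim :: "('a, 'o) psgp \<Rightarrow> 'a \<Rightarrow> 'a \<Rightarrow> bool" where
  "psim S x y \<longleftrightarrow> pdom S x = pdom S y \<and> pcod S x = pcod S y"

definition is_ideal :: "('a, 'o) psgp \<Rightarrow> 'a set \<Rightarrow> bool" where
  "is_ideal S I \<longleftrightarrow> I \<noteq> {} \<and> I \<subseteq> pmor S \<and>
     (\<forall>x \<in> I. \<forall>s \<in> pmor S. (pcod S s = pdom S x \<longrightarrow> pmult S s x \<in> I) \<and>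
                        (pcod S x = pdom S s \<longrightarrow> pmult S x s \<in> I))"

definition psub :: "('a, 'o) psgp \<Rightarrow> 'a set \<Rightarrow> ('a, 'o) psgp" where
  "psub S I = S\<lparr>pmor := I\<rparr>"

definition is_identity_at :: "('a, 'o) psgp \<Rightarrow> 'o \<Rightarrow> 'a \<Rightarrow> bool" where
  "is_identity_at S c e \<longleftrightarrow> e \<in> pmor S \<and> pdom S e = c \<and> pcod S e = c \<and>
     (\<forall>x \<in> pmor S. (pdom S x = c \<longrightarrow> pmult S e x = x) \<and> (pcod S x = c \<longrightarrow> pmult S x e = x))"

text \<open>
  The category \<open>S\<^sup>1\<close>: its morphisms are \<open>Inl x\<close> for morphisms \<open>x\<close> of \<open>S\<close>, together with a new
  identity \<open>Inr c\<close> at each object \<open>c\<close> where \<open>S\<close> has no identity.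
\<close>

definition adj1 :: "('a, 'o) psgp \<Rightarrow> ('a + 'o, 'o) psgp" where
  "adj1 S = \<lparr>
     pmor = Inl ` pmor S \<union> Inr ` {c \<in> pobj S. \<not> (\<exists>e. is_identity_at S c e)},
     pobj = pobj S,
     pdom = case_sum (pdom S) id,
     pcod = case_sum (pcod S) id,
     pmult = (\<lambda>u v. case u of
        Inr c \<Rightarrow> v
      | Inl x \<Rightarrow> (case v of Inr c \<Rightarrow> Inl x | Inl y \<Rightarrow> Inl (pmult S x y)))\<rparr>"

text \<open>
  The sets \<open>xS\<^sup>1\<close>, \<open>S\<^sup>1x\<close> and \<open>S\<^sup>1xS\<^sup>1\<close>, as sets of morphisms of \<open>S\<^sup>1\<close>.
\<close>

definition right_principal :: "('a, 'o) psgp \<Rightarrow> 'a \<Rightarrow> ('a + 'o) set" where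
  "right_principal S x =
     {pmult (adj1 S) (Inl x) s | s. s \<in> pmor (adj1 S) \<and> pcod S x = pdom (adj1 S) s}"

definition left_principal :: "('a, 'o) psgp \<Rightarrow> 'a \<Rightarrow> ('a + 'o) set" where
  "left_principal S x =
     {pmult (adj1 S) s (Inl x) | s. s \<in> pmor (adj1 S) \<and> pcod (adj1 S) s = pdom S x}"

definition principal :: "('a, 'o) psgp \<Rightarrow> 'a \<Rightarrow> ('a + 'o) set" where
  "principal S x =
     {pmult (adj1 S) (pmult (adj1 S) s (Inl x)) t | s t.
        s \<in> pmor (adj1 S) \<and> t \<in> pmor (adj1 S) \<and>
        pcod (adj1 S) s = pdom S x \<and> pcod S x = pdom (adj1 S) t}"

definition greenR :: "('a, 'o) psgp \<Rightarrow> 'a rel" where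
  "greenR S = {(x, y). x \<in> pmor S \<and> y \<in> pmor S \<and> right_principal S x = right_principal S y}"

definition greenL :: "('a, 'o) psgp \<Rightarrow> 'a rel" where
  "greenL S = {(x, y). x \<in> pmor S \<and> y \<in> pmor S \<and> left_principal S x = left_principal S y}"

definition greenJ :: "('a, 'o) psgp \<Rightarrow> 'a rel" where
  "greenJ S = {(x, y). x \<in> pmor S \<and> y \<in> pmor S \<and> principal S x = principal S y}"

definition greenH :: "('a, 'o) psgp \<Rightarrow> 'a rel" where
  "greenH S = greenR S \<inter> greenL S"

text \<open>The join of \<open>greenR S\<close> and \<open>greenL S\<close> in the lattice of equivalence relations on \<open>pmor S\<close>.\<close>

definition greenD :: "('a, 'o) psgp \<Rightarrow> 'a rel" where
  "greenD S = \<Inter>{E. equiv (pmor S) E \<and> greenR S \<union> greenL S \<subseteq> E}"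

definition J_classes :: "('a, 'o) psgp \<Rightarrow> 'a set set" where
  "J_classes S = pmor S // greenJ S"

definition J_le :: "('a, 'o) psgp \<Rightarrow> 'a set \<Rightarrow> 'a set \<Rightarrow> bool" where
  "J_le S A B \<longleftrightarrow> (\<exists>x \<in> A. \<exists>y \<in> B. Inl x \<in> principal S y)"

definition J_less :: "('a, 'o) psgp \<Rightarrow> 'a set \<Rightarrow> 'a set \<Rightarrow> bool" where
  "J_less S A B \<longleftrightarrow> J_le S A B \<and> A \<noteq> B"

definition is_regular_elem :: "('a, 'o) psgp \<Rightarrow> 'a \<Rightarrow> bool" where
  "is_regular_elem S x \<longleftrightarrow> (\<exists>a \<in> pmor S. pcod S x = pdom S a \<and> pcod S a = pdom S x \<and>
                              x = pmult S (pmult S x a) x)"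

definition is_regular :: "('a, 'o) psgp \<Rightarrow> bool" where
  "is_regular S \<longleftrightarrow> (\<forall>x \<in> pmor S. is_regular_elem S x)"

definition stable_class :: "('a, 'o) psgp \<Rightarrow> 'a set \<Rightarrow> bool" where
  "stable_class S J \<longleftrightarrow> (\<forall>x \<in> J. \<forall>a \<in> pmor S.
     (pcod S x = pdom S a \<and> (x, pmult S x a) \<in> greenJ S \<longrightarrow> (x, pmult S x a) \<in> greenR S) \<and>
     (pcod S a = pdom S x \<and> (x, pmult S a x) \<in> greenJ S \<longrightarrow> (x, pmult S a x) \<in> greenL S))"

definition is_stable :: "('a, 'o) psgp \<Rightarrow> bool" where
  "is_stable S \<longleftrightarrow> (\<forall>J \<in> J_classes S. stable_class S J)"

text \<open>
  The value \<open>\<infinity>\<close> of \<open>\<xi>\<close> stands for \<open>\<omega>\<close>. The classes are listed in increasing order by \<open>D\<close>, whose values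
  at indices outside \<open>{q. enat q < \<xi>}\<close> are irrelevant. By \<open>greenJ_eq_greenD\<close> below, stability makes
  the \<open>\<J>\<close>-classes of \<open>U\<close> its \<open>\<D>\<close>-classes.
\<close>

definition chain_of_ideals :: "('a, 'o) psgp \<Rightarrow> enat \<Rightarrow> (nat \<Rightarrow> 'a set) \<Rightarrow> bool" where
  "chain_of_ideals U \<xi> D \<longleftrightarrow>
     partial_semigroup U \<and> is_stable U \<and> is_regular U \<and> 1 \<le> \<xi> \<and>
     bij_betw D {q. enat q < \<xi>} (J_classes U) \<and>
     (\<forall>p q. enat p < \<xi> \<and> enat q < \<xi> \<longrightarrow> (p < q \<longleftrightarrow> J_less U (D p) (D q)))"

definition chain_ideal :: "('a, 'o) psgp \<Rightarrow> (nat \<Rightarrow> 'a set) \<Rightarrow> enat \<Rightarrow> 'a set" where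
  "chain_ideal U D r = (case r of enat n \<Rightarrow> (\<Union>q \<le> n. D q) | \<infinity> \<Rightarrow> pmor U)"

definition class_group :: "('a, 'o) psgp \<Rightarrow> 'a set \<Rightarrow> 'a monoid" where
  "class_group S H = \<lparr>carrier = H, mult = pmult S,
      one = (THE e. e \<in> H \<and> (\<forall>x \<in> H. pmult S e x = x \<and> pmult S x e = x))\<rparr>"

definition group_H_class :: "('a, 'o) psgp \<Rightarrow> 'a set \<Rightarrow> bool" where
  "group_H_class S H \<longleftrightarrow> H \<in> pmor S // greenH S \<and>
     (\<forall>x \<in> H. \<forall>y \<in> H. pcod S x = pdom S y) \<and> group (class_group S H)"

definition congruence :: "('a, 'o) psgp \<Rightarrow> 'a rel \<Rightarrow> bool" where
  "congruence S \<sigma> \<longleftrightarrow> equiv (pmor S) \<sigma> \<and>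
     (\<forall>(x, y) \<in> \<sigma>. psim S x y \<and>
        (\<forall>a \<in> pmor S. (pcod S a = pdom S x \<longrightarrow> (pmult S a x, pmult S a y) \<in> \<sigma>) \<and>
                      (pdom S a = pcod S x \<longrightarrow> (pmult S x a, pmult S y a) \<in> \<sigma>)))"

definition Cong :: "('a, 'o) psgp \<Rightarrow> 'a rel set" where
  "Cong S = {\<sigma>. congruence S \<sigma>}"

definition cong_gen :: "('a, 'o) psgp \<Rightarrow> 'a \<Rightarrow> 'a \<Rightarrow> 'a rel" where
  "cong_gen S x y = \<Inter>{\<sigma> \<in> Cong S. (x, y) \<in> \<sigma>}"

definition nabla :: "('a, 'o) psgp \<Rightarrow> 'a rel" where
  "nabla S = {(x, y). x \<in> pmor S \<and> y \<in> pmor S \<and> psim S x y}"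

definition Rees_cong :: "('a, 'o) psgp \<Rightarrow> 'a set \<Rightarrow> 'a rel" where
  "Rees_cong S I = nabla (psub S I) \<union> Id_on (pmor S)"

text \<open>
  The relation \<open>\<nu>\<^sub>N\<close>; the argument \<open>D\<close> is the \<open>\<J>\<close>-class containing the group \<open>\<H>\<close>-class
  in which \<open>N\<close> is a normal subgroup.
\<close>

definition nu_rel :: "('a, 'o) psgp \<Rightarrow> 'a set \<Rightarrow> 'a set \<Rightarrow> 'a rel" where
  "nu_rel S D N = {(u, v). u \<in> D \<and> v \<in> D \<and>
     (\<exists>x \<in> N. \<exists>y \<in> N. \<exists>a \<in> pmor (adj1 S). \<exists>b \<in> pmor (adj1 S).
        pcod (adj1 S) a = pdom S x \<and> pcod S x = pdom (adj1 S) b \<and>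
        pcod (adj1 S) a = pdom S y \<and> pcod S y = pdom (adj1 S) b \<and>
        Inl u = pmult (adj1 S) (pmult (adj1 S) a (Inl x)) b \<and>
        Inl v = pmult (adj1 S) (pmult (adj1 S) a (Inl y)) b)}"

definition Rees_normal_cong :: "('a, 'o) psgp \<Rightarrow> 'a set \<Rightarrow> 'a set \<Rightarrow> 'a set \<Rightarrow> 'a rel" where
  "Rees_normal_cong S I D N = Rees_cong S I \<union> nu_rel S D N"

definition liftable :: "('a, 'o) psgp \<Rightarrow> 'a rel \<Rightarrow> bool" where
  "liftable T \<sigma> \<longleftrightarrow> \<sigma> \<union> Id_on (pmor T) \<in> Cong T"

definition liftable_Cong :: "('a, 'o) psgp \<Rightarrow> 'a set \<Rightarrow> 'a rel set" where
  "liftable_Cong T I = {\<sigma> \<in> Cong (psub T I). liftable T \<sigma>}"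

definition is_max_J_class :: "('a, 'o) psgp \<Rightarrow> 'a set \<Rightarrow> bool" where
  "is_max_J_class T M \<longleftrightarrow> M \<in> J_classes T \<and> (\<forall>J \<in> J_classes T. J_le T J M)"

definition top_class :: "('a, 'o) psgp \<Rightarrow> 'a set" where
  "top_class T = (THE M. is_max_J_class T M)"

definition Dmax :: "('a, 'o) psgp \<Rightarrow> bool" where
  "Dmax T \<longleftrightarrow> (\<exists>M. is_max_J_class T M \<and> (\<forall>x \<in> M. is_regular_elem T x) \<and> stable_class T M)"

definition nabla_gen :: "('a, 'o) psgp \<Rightarrow> bool" where
  "nabla_gen T \<longleftrightarrow> Dmax T \<and>
     (\<forall>x \<in> top_class T. \<forall>y \<in> pmor T - greenH T `` {x}. psim T x y \<longrightarrow> cong_gen T x y = nabla T)"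

text \<open>
  In the following definition, the complement of the top class is closed under multiplication by
  elements of \<open>T\<close>, and it is non-empty because of the conjunct \<open>Dmax S\<close>, so it is an ideal.
\<close>

definition Sep :: "('a, 'o) psgp \<Rightarrow> bool" where
  "Sep T \<longleftrightarrow> Dmax T \<and>
     (let S = psub T (pmor T - top_class T) in
        Dmax S \<and>
        (\<forall>x \<in> top_class T. \<forall>y \<in> pmor S. psim T x y \<longrightarrow>
           (\<exists>(x', y') \<in> cong_gen T x y. x' \<in> top_class S \<and> y' \<in> pmor S - greenH S `` {x'})) \<and>
        (\<forall>x \<in> top_class T. \<forall>y \<in> top_class T - greenH T `` {x}. psim T x y \<longrightarrow>
           (\<exists>(x', y') \<in> cong_gen T x y. x' \<in> top_class T \<and> y' \<in> pmor S)) \<and>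
        (\<forall>x \<in> top_class T. \<forall>y \<in> greenH T `` {x} - {x}.
           (\<exists>(x', y') \<in> cong_gen T x y. x' \<in> top_class S \<and> y' \<in> pmor S - greenH S `` {x'})))"

lemma psub_simps [simp]:
  "pmor (psub S I) = I" "pobj (psub S I) = pobj S" "pdom (psub S I) = pdom S"
  "pcod (psub S I) = pcod S" "pmult (psub S I) = pmult S"
  by (simp_all add: psub_def)

lemma adj1_simps [simp]:
  "pobj (adj1 S) = pobj S"
  "pdom (adj1 S) (Inl x) = pdom S x" "pdom (adj1 S) (Inr c) = c"
  "pcod (adj1 S) (Inl x) = pcod S x" "pcod (adj1 S) (Inr c) = c"
  "pmult (adj1 S) (Inl x) (Inl y) = Inl (pmult S x y)"
  "pmult (adj1 S) (Inl x) (Inr c) = Inl x"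
  "pmult (adj1 S) (Inr c) v = v"
  "Inl x \<in> pmor (adj1 S) \<longleftrightarrow> x \<in> pmor S"
  by (auto simp: adj1_def)

lemma partial_semigroup_psub:
  assumes "partial_semigroup S" "is_ideal S I"
  shows "partial_semigroup (psub S I)"
  using assms unfolding partial_semigroup_def is_ideal_def by (auto simp: subset_iff)

lemma partial_semigroup_adj1:
  assumes "partial_semigroup S"
  shows "partial_semigroup (adj1 S)"
  using assms unfolding partial_semigroup_def adj1_def
  by (auto split: sum.splits)

lemma adj1_identity:
  assumes S: "partial_semigroup S" and c: "c \<in> pobj S"
  shows "\<exists>e. is_identity_at (adj1 S) c e"
proof (cases "\<exists>e. is_identity_at S c e")
  case True
  then obtain e where e: "is_identity_at S c e" by blast
  then have "is_identity_at (adj1 S) c (Inl e)"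
    using e[unfolded is_identity_at_def]
    unfolding is_identity_at_def[of "adj1 S"] by (auto simp: adj1_def)
  then show ?thesis by blast
next
  case False
  then have "is_identity_at (adj1 S) c (Inr c)"
    using c False unfolding is_identity_at_def[of "adj1 S"] by (auto simp: adj1_def)
  then show ?thesis by blast
qed

lemma right_principal_eq:
  assumes S: "partial_semigroup S" and x: "x \<in> pmor S"
  shows "right_principal S x = Inl ` ({x} \<union> {pmult S x s | s. s \<in> pmor S \<and> pcod S x = pdom S s})"
    (is "_ = ?R")
proof
  show "right_principal S x \<subseteq> ?R"
    unfolding right_principal_def by (auto simp: adj1_def inj_image_mem_iff[OF inj_Inl])
  have "pcod S x \<in> pobj S" using S x by (auto simp: partial_semigroup_def)
  from adj1_identity[OF S this] obtain e where e: "is_identity_at (adj1 S) (pcod S x) e" by blast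
  then have "pmult (adj1 S) (Inl x) e = Inl x"
    using x unfolding is_identity_at_def by force
  then have "Inl x \<in> right_principal S x"
    using e unfolding right_principal_def is_identity_at_def
    by (intro CollectI exI[of _ e]) simp
  moreover have "Inl (pmult S x s) \<in> right_principal S x"
    if "s \<in> pmor S" "pcod S x = pdom S s" for s
    unfolding right_principal_def using that by (auto intro!: exI[of _ "Inl s"])
  ultimately show "?R \<subseteq> right_principal S x" by auto
qed

lemma left_principal_eq:
  assumes S: "partial_semigroup S" and x: "x \<in> pmor S"
  shows "left_principal S x = Inl ` ({x} \<union> {pmult S s x | s. s \<in> pmor S \<and> pcod S s = pdom S x})"
    (is "_ = ?R")
proof
  show "left_principal S x \<subseteq> ?R"
    unfolding left_principal_def by (auto simp: adj1_def inj_image_mem_iff[OF inj_Inl])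
  have "pdom S x \<in> pobj S" using S x by (auto simp: partial_semigroup_def)
  from adj1_identity[OF S this] obtain e where e: "is_identity_at (adj1 S) (pdom S x) e" by blast
  then have "pmult (adj1 S) e (Inl x) = Inl x"
    using x unfolding is_identity_at_def by force
  then have "Inl x \<in> left_principal S x"
    using e unfolding left_principal_def is_identity_at_def
    by (intro CollectI exI[of _ e]) simp
  moreover have "Inl (pmult S s x) \<in> left_principal S x"
    if "s \<in> pmor S" "pcod S s = pdom S x" for s
    unfolding left_principal_def using that by (auto intro!: exI[of _ "Inl s"])
  ultimately show "?R \<subseteq> left_principal S x" by auto
qed

lemma Inl_in_principal:
  assumes S: "partial_semigroup S" and x: "x \<in> pmor S"
  shows "Inl y \<in> principal S x \<longleftrightarrow>
    (\<exists>z. Inl z \<in> left_principal S x \<and> z \<in> pmor S \<and> Inl y \<in> right_principal S z)"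
proof
  assume "Inl y \<in> principal S x"
  then obtain s t where st: "s \<in> pmor (adj1 S)" "t \<in> pmor (adj1 S)"
    "pcod (adj1 S) s = pdom S x" "pcod S x = pdom (adj1 S) t"
    "Inl y = pmult (adj1 S) (pmult (adj1 S) s (Inl x)) t"
    unfolding principal_def by auto
  obtain z where z: "pmult (adj1 S) s (Inl x) = Inl z"
    by (cases s) auto
  have zm: "z \<in> pmor S \<and> pcod S z = pcod S x"
  proof (cases s)
    case (Inl a)
    then show ?thesis using st z S x by (auto simp: partial_semigroup_def)
  next
    case (Inr c)
    then show ?thesis using z x by auto
  qed
  have "Inl z \<in> left_principal S x"
    unfolding left_principal_def using st(1,3) z by force
  moreover have "Inl y \<in> right_principal S z"
    unfolding right_principal_def using st(2,4,5) z zm by auto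
  ultimately show "\<exists>z. Inl z \<in> left_principal S x \<and> z \<in> pmor S \<and> Inl y \<in> right_principal S z"
    using zm by blast
next
  assume "\<exists>z. Inl z \<in> left_principal S x \<and> z \<in> pmor S \<and> Inl y \<in> right_principal S z"
  then obtain z s t where z: "z \<in> pmor S"
    and s: "Inl z = pmult (adj1 S) s (Inl x)" "s \<in> pmor (adj1 S)" "pcod (adj1 S) s = pdom S x"
    and t: "Inl y = pmult (adj1 S) (Inl z) t" "t \<in> pmor (adj1 S)" "pcod S z = pdom (adj1 S) t"
    unfolding left_principal_def right_principal_def by auto
  have "pcod S z = pcod S x"
    using s S x by (cases s) (auto simp: partial_semigroup_def)
  then show "Inl y \<in> principal S x"
    unfolding principal_def using s t by force
qed

lemma principal_trans:
  assumes S: "partial_semigroup S" and x: "x \<in> pmor S" and y: "y \<in> pmor S"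
    and "Inl x \<in> principal S y"
  shows "principal S x \<subseteq> principal S y"
proof
  have assoc: "pmult (adj1 S) (pmult (adj1 S) a b) c = pmult (adj1 S) a (pmult (adj1 S) b c)"
    if "a \<in> pmor (adj1 S)" "b \<in> pmor (adj1 S)" "c \<in> pmor (adj1 S)"
      "pcod (adj1 S) a = pdom (adj1 S) b" "pcod (adj1 S) b = pdom (adj1 S) c" for a b c
    using partial_semigroup_adj1[OF S] that unfolding partial_semigroup_def by blast
  have clo: "pmult (adj1 S) a b \<in> pmor (adj1 S) \<and> pdom (adj1 S) (pmult (adj1 S) a b) = pdom (adj1 S) a
      \<and> pcod (adj1 S) (pmult (adj1 S) a b) = pcod (adj1 S) b"
    if "a \<in> pmor (adj1 S)" "b \<in> pmor (adj1 S)" "pcod (adj1 S) a = pdom (adj1 S) b" for a b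
    using partial_semigroup_adj1[OF S] that unfolding partial_semigroup_def by blast
  fix w assume "w \<in> principal S x"
  then obtain s t where st: "s \<in> pmor (adj1 S)" "t \<in> pmor (adj1 S)"
    "pcod (adj1 S) s = pdom (adj1 S) (Inl x)" "pcod (adj1 S) (Inl x) = pdom (adj1 S) t"
    "w = pmult (adj1 S) (pmult (adj1 S) s (Inl x)) t"
    unfolding principal_def by auto
  obtain p q where pq: "p \<in> pmor (adj1 S)" "q \<in> pmor (adj1 S)"
    "pcod (adj1 S) p = pdom (adj1 S) (Inl y)" "pcod (adj1 S) (Inl y) = pdom (adj1 S) q"
    "Inl x = pmult (adj1 S) (pmult (adj1 S) p (Inl y)) q"
    using assms(4) unfolding principal_def by auto
  have y': "Inl y \<in> pmor (adj1 S)" using y by simp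
  have py: "pmult (adj1 S) p (Inl y) \<in> pmor (adj1 S)"
    "pdom (adj1 S) (pmult (adj1 S) p (Inl y)) = pdom (adj1 S) p"
    "pcod (adj1 S) (pmult (adj1 S) p (Inl y)) = pcod (adj1 S) (Inl y)"
    using clo[OF pq(1) y' pq(3)] by auto
  have x': "pdom (adj1 S) (Inl x) = pdom (adj1 S) p" "pcod (adj1 S) (Inl x) = pcod (adj1 S) q"
    using clo[OF py(1) pq(2)] py pq by auto
  have sp: "pmult (adj1 S) s p \<in> pmor (adj1 S)" "pcod (adj1 S) (pmult (adj1 S) s p) = pdom (adj1 S) (Inl y)"
    using clo[OF st(1) pq(1)] st x' pq by auto
  have qt: "pmult (adj1 S) q t \<in> pmor (adj1 S)" "pdom (adj1 S) (pmult (adj1 S) q t) = pcod (adj1 S) (Inl y)"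
    using clo[OF pq(2) st(2)] st x' pq by auto
  have spy: "pmult (adj1 S) s (pmult (adj1 S) p (Inl y)) = pmult (adj1 S) (pmult (adj1 S) s p) (Inl y)"
    using assoc[OF st(1) pq(1) y'] st(3) x'(1) pq(3) by metis
  have m: "pmult (adj1 S) (pmult (adj1 S) s p) (Inl y) \<in> pmor (adj1 S)"
    "pcod (adj1 S) (pmult (adj1 S) (pmult (adj1 S) s p) (Inl y)) = pcod (adj1 S) (Inl y)"
    using clo[OF sp(1) y' sp(2)] by auto
  have "pmult (adj1 S) s (Inl x) = pmult (adj1 S) (pmult (adj1 S) s (pmult (adj1 S) p (Inl y))) q"
    unfolding pq(5) using assoc[OF st(1) py(1) pq(2)] st(3) x'(1) py(2,3) pq(4) by metis
  then have "w = pmult (adj1 S) (pmult (adj1 S) (pmult (adj1 S) (pmult (adj1 S) s p) (Inl y)) q) t"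
    unfolding st(5) spy by simp
  also have "\<dots> = pmult (adj1 S) (pmult (adj1 S) (pmult (adj1 S) s p) (Inl y)) (pmult (adj1 S) q t)"
    using assoc[OF m(1) pq(2) st(2)] m(2) pq(4) st(4) x'(2) by metis
  finally show "w \<in> principal S y"
    unfolding principal_def
    by (intro CollectI exI[of _ "pmult (adj1 S) s p"] exI[of _ "pmult (adj1 S) q t"] conjI)
      (use sp qt in auto)
qed

lemma in_principal_self:
  assumes S: "partial_semigroup S" and x: "x \<in> pmor S"
  shows "Inl x \<in> principal S x"
  unfolding Inl_in_principal[OF S x] using x right_principal_eq[OF S x] left_principal_eq[OF S x] by blast

lemma equiv_greenJ: "equiv (pmor S) (greenJ S)"
  by (rule equivI) (auto simp: greenJ_def refl_on_def sym_def trans_def)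

theorem greenJ_eq_greenD:
  assumes S: "partial_semigroup S" and st: "is_stable S"
  shows "greenJ S = greenD S"
proof
  have R_J: "greenR S \<subseteq> greenJ S"
  proof clarify
    fix x y assume xy: "(x, y) \<in> greenR S"
    then have m: "x \<in> pmor S" "y \<in> pmor S" and e: "right_principal S x = right_principal S y"
      by (auto simp: greenR_def)
    have "Inl x \<in> principal S y" "Inl y \<in> principal S x"
      unfolding Inl_in_principal[OF S m(1)] Inl_in_principal[OF S m(2)]
      using m e right_principal_eq[OF S] left_principal_eq[OF S] by blast+
    then show "(x, y) \<in> greenJ S"
      using principal_trans[OF S] m by (auto simp: greenJ_def)
  qed
  have L_J: "greenL S \<subseteq> greenJ S"
  proof clarify
    fix x y assume xy: "(x, y) \<in> greenL S"
    then have m: "x \<in> pmor S" "y \<in> pmor S" and e: "left_principal S x = left_principal S y"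
      by (auto simp: greenL_def)
    have "Inl x \<in> principal S y" "Inl y \<in> principal S x"
      unfolding Inl_in_principal[OF S m(1)] Inl_in_principal[OF S m(2)]
      using m e right_principal_eq[OF S] left_principal_eq[OF S] by blast+
    then show "(x, y) \<in> greenJ S"
      using principal_trans[OF S] m by (auto simp: greenJ_def)
  qed
  show "greenD S \<subseteq> greenJ S"
    unfolding greenD_def using equiv_greenJ R_J L_J by blast
  show "greenJ S \<subseteq> greenD S"
  proof (clarsimp simp: greenD_def)
    fix x y E assume J: "(x, y) \<in> greenJ S" and E: "equiv (pmor S) E"
      and RE: "greenR S \<subseteq> E" and LE: "greenL S \<subseteq> E"
    from J have m: "x \<in> pmor S" "y \<in> pmor S" and e: "principal S x = principal S y"
      by (auto simp: greenJ_def)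
    have stab: "stable_class S (greenJ S `` {u})" if "u \<in> pmor S" for u
      using st that by (auto simp: is_stable_def J_classes_def quotient_def)
    have self: "u \<in> greenJ S `` {u}" if "u \<in> pmor S" for u
      using that by (auto simp: greenJ_def)
    have "Inl y \<in> principal S x" using in_principal_self[OF S m(2)] e by simp
    then obtain z where z: "Inl z \<in> left_principal S x" "z \<in> pmor S" "Inl y \<in> right_principal S z"
      unfolding Inl_in_principal[OF S m(1)] by blast
    have zx: "Inl z \<in> principal S x"
      unfolding Inl_in_principal[OF S m(1)] using z right_principal_eq[OF S z(2)] by blast
    have yz: "Inl y \<in> principal S z"
      unfolding Inl_in_principal[OF S z(2)] using z left_principal_eq[OF S z(2)] by blast
    have "principal S z \<subseteq> principal S x" "principal S y \<subseteq> principal S z"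
      using principal_trans[OF S] zx yz m z(2) by blast+
    then have eqs: "principal S z = principal S x" "principal S z = principal S y"
      using e by blast+
    have "(x, z) \<in> E"
    proof (cases "z = x")
      case True
      then show ?thesis using E m by (auto simp: equiv_def refl_on_def)
    next
      case False
      then obtain s where "z = pmult S s x" "s \<in> pmor S" "pcod S s = pdom S x"
        using z(1) left_principal_eq[OF S m(1)] by auto
      moreover have "(x, z) \<in> greenJ S" using m z(2) eqs by (auto simp: greenJ_def)
      ultimately have "(x, z) \<in> greenL S"
        using stab[OF m(1)] self[OF m(1)] unfolding stable_class_def by blast
      then show ?thesis using LE by blast
    qed
    moreover have "(z, y) \<in> E"
    proof (cases "y = z")
      case True
      then show ?thesis using E m by (auto simp: equiv_def refl_on_def)
    next
      case False
      then obtain s where "y = pmult S z s" "s \<in> pmor S" "pcod S z = pdom S s"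
        using z(3) right_principal_eq[OF S z(2)] by auto
      moreover have "(z, y) \<in> greenJ S" using m z(2) eqs by (auto simp: greenJ_def)
      ultimately have "(z, y) \<in> greenR S"
        using stab[OF z(2)] self[OF z(2)] unfolding stable_class_def by blast
      then show ?thesis using RE by blast
    qed
    ultimately show "(x, y) \<in> E"
      using E by (meson equivE transD)
  qed
qed

end

theory Submission
  imports Defs
begin

text \<open>
  Write \<open>\<nabla>\<^sub>m\<close> for the universal congruence on \<open>I\<^sub>m\<close>. The separation properties propagate
  \<open>\<nabla>gen\<close> upwards: a pair \<open>(x, y)\<close> with \<open>x \<in> D\<^sub>m\<^sub>+\<^sub>1\<close> and \<open>y\<close> outside its \<open>\<H>\<close>-class generates a pair that
  collapses \<open>I\<^sub>m\<close> by induction, and also relates some element of \<open>D\<^sub>m\<^sub>+\<^sub>1\<close>, hence (by multiplication)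
  every one, to an element of \<open>I\<^sub>m\<close>. Thus a congruence \<open>\<sigma>\<close> is governed by the \<open>m \<ge> k\<close> with
  \<open>\<nabla>\<^sub>m \<subseteq> \<sigma>\<close>. If there is none, \<open>\<sigma>\<close> lives on \<open>I\<^sub>k\<close>; if all qualify, \<open>\<sigma>\<close> is universal; and if \<open>q\<close> is the
  largest one, all other non-trivial pairs of \<open>\<sigma>\<close> lie in \<open>\<H>\<close>-classes of \<open>D\<^sub>q\<^sub>+\<^sub>1\<close>, where they are
  determined by the normal subgroup \<open>{y \<in> G\<^sub>q\<^sub>+\<^sub>1. (e, y) \<in> \<sigma>}\<close>. No induction on \<open>r\<close> is needed, so
  \<open>r = \<omega>\<close> is not a special case.
\<close>

section \<open>Congruences\<close>

lemma psub_psub [simp]: "psub (psub S X) I = psub S I"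
  by (simp add: psub_def)

lemma psim_psub [simp]: "psim (psub S X) x y = psim S x y"
  by (simp add: psim_def)

lemma nabla_psub_iff [simp]: "(x, y) \<in> nabla (psub S X) \<longleftrightarrow> x \<in> X \<and> y \<in> X \<and> psim S x y"
  by (simp add: nabla_def)

lemma equiv_nabla: "equiv (pmor S) (nabla S)"
  by (rule equivI) (auto simp: nabla_def psim_def refl_on_def sym_def trans_def)

lemma CongI:
  assumes "equiv (pmor S) \<sigma>"
    and "\<And>x y. (x, y) \<in> \<sigma> \<Longrightarrow> psim S x y"
    and "\<And>x y a. (x, y) \<in> \<sigma> \<Longrightarrow> a \<in> pmor S \<Longrightarrow> pcod S a = pdom S x
      \<Longrightarrow> (pmult S a x, pmult S a y) \<in> \<sigma>"
    and "\<And>x y a. (x, y) \<in> \<sigma> \<Longrightarrow> a \<in> pmor S \<Longrightarrow> pdom S a = pcod S x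
      \<Longrightarrow> (pmult S x a, pmult S y a) \<in> \<sigma>"
  shows "\<sigma> \<in> Cong S"
  using assms unfolding Cong_def congruence_def by auto

lemma CongD:
  assumes "\<sigma> \<in> Cong S"
  shows Cong_equiv: "equiv (pmor S) \<sigma>"
    and Cong_psim: "(x, y) \<in> \<sigma> \<Longrightarrow> psim S x y"
    and Cong_left: "(x, y) \<in> \<sigma> \<Longrightarrow> a \<in> pmor S \<Longrightarrow> pcod S a = pdom S x
      \<Longrightarrow> (pmult S a x, pmult S a y) \<in> \<sigma>"
    and Cong_right: "(x, y) \<in> \<sigma> \<Longrightarrow> a \<in> pmor S \<Longrightarrow> pdom S a = pcod S x
      \<Longrightarrow> (pmult S x a, pmult S y a) \<in> \<sigma>"
  using assms unfolding Cong_def congruence_def by auto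

lemma Cong_mor: "\<sigma> \<in> Cong S \<Longrightarrow> (x, y) \<in> \<sigma> \<Longrightarrow> x \<in> pmor S \<and> y \<in> pmor S"
  using Cong_equiv by (auto simp: equiv_def)

lemma Cong_refl: "\<sigma> \<in> Cong S \<Longrightarrow> x \<in> pmor S \<Longrightarrow> (x, x) \<in> \<sigma>"
  using Cong_equiv by (auto simp: equiv_def refl_on_def)

lemma Cong_sym: "\<sigma> \<in> Cong S \<Longrightarrow> (x, y) \<in> \<sigma> \<Longrightarrow> (y, x) \<in> \<sigma>"
  using Cong_equiv by (auto simp: equiv_def sym_def)

lemma Cong_trans: "\<sigma> \<in> Cong S \<Longrightarrow> (x, y) \<in> \<sigma> \<Longrightarrow> (y, z) \<in> \<sigma> \<Longrightarrow> (x, z) \<in> \<sigma>"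
  using Cong_equiv by (meson equivE transD)

lemma Cong_subset_nabla: "\<sigma> \<in> Cong S \<Longrightarrow> \<sigma> \<subseteq> nabla S"
  using Cong_mor Cong_psim by (fastforce simp: nabla_def)

lemma nabla_Cong: "partial_semigroup S \<Longrightarrow> nabla S \<in> Cong S"
  by (rule CongI[OF equiv_nabla]) (auto simp: nabla_def psim_def partial_semigroup_def)

lemma cong_gen_subset: "\<sigma> \<in> Cong S \<Longrightarrow> (x, y) \<in> \<sigma> \<Longrightarrow> cong_gen S x y \<subseteq> \<sigma>"
  by (auto simp: cong_gen_def)

text \<open>The ambient \<open>X\<close> stays arbitrary so that a congruence on one chain ideal can
  be cut down to a smaller one, and, with \<open>X = pmor U\<close>, one on all of \<open>U\<close>
  to any chain ideal.\<close>

lemma Cong_restrict: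
  assumes \<sigma>: "\<sigma> \<in> Cong (psub S X)" and I: "is_ideal S I" "I \<subseteq> X"
  shows "\<sigma> \<inter> I \<times> I \<in> Cong (psub S I)"
proof (rule CongI)
  show "equiv (pmor (psub S I)) (\<sigma> \<inter> I \<times> I)"
  proof (rule equivI)
    show "refl_on (pmor (psub S I)) (\<sigma> \<inter> I \<times> I)"
      using I(2) Cong_refl[OF \<sigma>] by (auto simp: refl_on_def)
    show "sym (\<sigma> \<inter> I \<times> I)"
      using Cong_sym[OF \<sigma>] by (auto intro: symI)
    show "trans (\<sigma> \<inter> I \<times> I)"
      by (rule transI) (blast intro: Cong_trans[OF \<sigma>])
  qed auto
  show "psim (psub S I) x y" if "(x, y) \<in> \<sigma> \<inter> I \<times> I" for x y
    using that Cong_psim[OF \<sigma>] by auto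
next
  fix x y a assume xy: "(x, y) \<in> \<sigma> \<inter> I \<times> I" and a: "a \<in> pmor (psub S I)"
  then have \<sigma>xy: "(x, y) \<in> \<sigma>" and m: "x \<in> I" "y \<in> I" "a \<in> X" "a \<in> pmor S"
    and p: "pdom S y = pdom S x" "pcod S y = pcod S x"
    using I Cong_psim[OF \<sigma>, of x y] by (auto simp: is_ideal_def psim_def)
  have I': "pmult S s z \<in> I" if "z \<in> I" "s \<in> pmor S" "pcod S s = pdom S z" for s z
    using I(1) that unfolding is_ideal_def by blast
  have I'': "pmult S z s \<in> I" if "z \<in> I" "s \<in> pmor S" "pcod S z = pdom S s" for s z
    using I(1) that unfolding is_ideal_def by blast
  show "(pmult (psub S I) a x, pmult (psub S I) a y) \<in> \<sigma> \<inter> I \<times> I"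
    if "pcod (psub S I) a = pdom (psub S I) x"
    using that m p I'[of x a] I'[of y a] Cong_left[OF \<sigma> \<sigma>xy, of a] by simp
  show "(pmult (psub S I) x a, pmult (psub S I) y a) \<in> \<sigma> \<inter> I \<times> I"
    if "pdom (psub S I) a = pcod (psub S I) x"
    using that m p I''[of x a] I''[of y a] Cong_right[OF \<sigma> \<sigma>xy, of a] by simp
qed

text \<open>The shape of the congruences above an ideal: \<open>\<alpha>\<close> becomes the
  universal relation on the ideal and \<open>\<beta>\<close> the relation \<open>nu N\<close> on the
  class above it. As the carriers are disjoint, no two consecutive pairs pass from one to the other,
  which gives transitivity.\<close>

lemma equiv_disjoint_union_Id_on:
  assumes "equiv A \<alpha>" "equiv B \<beta>" "A \<inter> B = {}" "A \<union> B \<subseteq> X"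
  shows "equiv X (\<alpha> \<union> Id_on X \<union> \<beta>)"
proof -
  have sub: "\<alpha> \<subseteq> A \<times> A" "\<beta> \<subseteq> B \<times> B" and "sym \<alpha>" "trans \<alpha>" "sym \<beta>" "trans \<beta>"
    using assms(1,2) by (auto simp: equiv_def)
  show ?thesis
  proof (rule equivI)
    show "\<alpha> \<union> Id_on X \<union> \<beta> \<subseteq> X \<times> X" using sub assms(4) by auto
    show "refl_on X (\<alpha> \<union> Id_on X \<union> \<beta>)" by (auto simp: refl_on_def)
    show "sym (\<alpha> \<union> Id_on X \<union> \<beta>)"
      using \<open>sym \<alpha>\<close> \<open>sym \<beta>\<close> by (auto simp: sym_def)
    show "trans (\<alpha> \<union> Id_on X \<union> \<beta>)"
    proof (rule transI)
      fix x y z assume "(x, y) \<in> \<alpha> \<union> Id_on X \<union> \<beta>" "(y, z) \<in> \<alpha> \<union> Id_on X \<union> \<beta>"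
      then show "(x, z) \<in> \<alpha> \<union> Id_on X \<union> \<beta>"
        using sub assms(3) transD[OF \<open>trans \<alpha>\<close>, of x y z] transD[OF \<open>trans \<beta>\<close>, of x y z] by blast
    qed
  qed
qed

section \<open>Green's relations on a regular partial semigroup\<close>

locale regular_partial_semigroup =
  fixes S :: "('a, 'o) psgp"
  assumes psg: "partial_semigroup S" and regular: "is_regular S"
begin

abbreviation mor :: "'a set" where "mor \<equiv> pmor S"
abbreviation dm :: "'a \<Rightarrow> 'o" where "dm \<equiv> pdom S"
abbreviation cd :: "'a \<Rightarrow> 'o" where "cd \<equiv> pcod S"
abbreviation mult :: "'a \<Rightarrow> 'a \<Rightarrow> 'a" (infixl "\<cdot>" 70) where "x \<cdot> y \<equiv> pmult S x y"

section \<open>Products and the three divisibility preorders\<close>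

lemma mult_simps [simp]:
  assumes "x \<in> mor" "y \<in> mor" "cd x = dm y"
  shows "x \<cdot> y \<in> mor" "dm (x \<cdot> y) = dm x" "cd (x \<cdot> y) = cd y"
  using psg assms unfolding partial_semigroup_def by auto

lemma mult_assoc:
  assumes "x \<in> mor" "y \<in> mor" "z \<in> mor" "cd x = dm y" "cd y = dm z"
  shows "x \<cdot> y \<cdot> z = x \<cdot> (y \<cdot> z)"
  using psg assms unfolding partial_semigroup_def by auto

lemma regular_elem:
  assumes "x \<in> mor"
  obtains a where "a \<in> mor" "dm a = cd x" "cd a = dm x" "x \<cdot> (a \<cdot> x) = x"
  using regular assms that unfolding is_regular_def is_regular_elem_def
  by (metis mult_assoc)

text \<open>The preorders behind Green's relations, with multipliers taken from \<open>S\<close>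
  instead of \<open>S\<^sup>1\<close>. Regularity provides a local identity,
  \<open>x = x \<cdot> (a \<cdot> x)\<close>, so nothing is lost and the adjoined identities can be
  forgotten.\<close>

definition R_below :: "'a \<Rightarrow> 'a \<Rightarrow> bool" where
  "R_below y x \<longleftrightarrow> (\<exists>s \<in> mor. dm s = cd x \<and> y = x \<cdot> s)"

definition L_below :: "'a \<Rightarrow> 'a \<Rightarrow> bool" where
  "L_below y x \<longleftrightarrow> (\<exists>s \<in> mor. cd s = dm x \<and> y = s \<cdot> x)"

definition J_below :: "'a \<Rightarrow> 'a \<Rightarrow> bool" where
  "J_below y x \<longleftrightarrow> (\<exists>s \<in> mor. \<exists>t \<in> mor. cd s = dm x \<and> dm t = cd x \<and> y = s \<cdot> x \<cdot> t)"

lemma R_belowI: "s \<in> mor \<Longrightarrow> dm s = cd x \<Longrightarrow> R_below (x \<cdot> s) x"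
  and L_belowI: "s \<in> mor \<Longrightarrow> cd s = dm x \<Longrightarrow> L_below (s \<cdot> x) x"
  by (auto simp: R_below_def L_below_def)

lemma R_belowE:
  assumes "R_below y x"
  obtains s where "s \<in> mor" "dm s = cd x" "y = x \<cdot> s"
  using assms by (auto simp: R_below_def)

lemma L_belowE:
  assumes "L_below y x"
  obtains s where "s \<in> mor" "cd s = dm x" "y = s \<cdot> x"
  using assms by (auto simp: L_below_def)

lemma J_belowI:
  "s \<in> mor \<Longrightarrow> t \<in> mor \<Longrightarrow> cd s = dm x \<Longrightarrow> dm t = cd x \<Longrightarrow> J_below (s \<cdot> x \<cdot> t) x"
  by (auto simp: J_below_def)

lemma J_belowE:
  assumes "J_below y x"
  obtains s t where "s \<in> mor" "t \<in> mor" "cd s = dm x" "dm t = cd x" "y = s \<cdot> x \<cdot> t"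
  using assms by (auto simp: J_below_def)

lemma R_below_refl: "x \<in> mor \<Longrightarrow> R_below x x"
proof -
  assume x: "x \<in> mor"
  obtain a where "a \<in> mor" "dm a = cd x" "cd a = dm x" "x \<cdot> (a \<cdot> x) = x"
    using regular_elem[OF x] .
  then show ?thesis using x R_belowI[of "a \<cdot> x" x] by simp
qed

lemma L_below_refl: "x \<in> mor \<Longrightarrow> L_below x x"
proof -
  assume x: "x \<in> mor"
  obtain a where "a \<in> mor" "dm a = cd x" "cd a = dm x" "x \<cdot> (a \<cdot> x) = x"
    using regular_elem[OF x] .
  then show ?thesis using x L_belowI[of "x \<cdot> a" x] by (simp add: mult_assoc)
qed

lemma R_below_trans:
  assumes x: "x \<in> mor" and "R_below y x" "R_below z y"
  shows "R_below z x"
proof -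
  obtain s where s: "s \<in> mor" "dm s = cd x" "y = x \<cdot> s" using assms(2) by (rule R_belowE)
  obtain t where t: "t \<in> mor" "dm t = cd y" "z = y \<cdot> t" using assms(3) by (rule R_belowE)
  have "z = x \<cdot> (s \<cdot> t)" using s t x by (simp add: mult_assoc)
  then show ?thesis using s t x R_belowI[of "s \<cdot> t" x] by simp
qed

lemma L_below_trans:
  assumes x: "x \<in> mor" and "L_below y x" "L_below z y"
  shows "L_below z x"
proof -
  obtain s where s: "s \<in> mor" "cd s = dm x" "y = s \<cdot> x" using assms(2) by (rule L_belowE)
  obtain t where t: "t \<in> mor" "cd t = dm y" "z = t \<cdot> y" using assms(3) by (rule L_belowE)
  have "z = t \<cdot> s \<cdot> x" using s t x by (simp add: mult_assoc)
  then show ?thesis using s t x L_belowI[of "t \<cdot> s" x] by simp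
qed

lemma J_below_trans:
  assumes "x \<in> mor" "J_below y x" "J_below z y"
  shows "J_below z x"
proof -
  obtain s t where st: "s \<in> mor" "t \<in> mor" "cd s = dm x" "dm t = cd x" "y = s \<cdot> x \<cdot> t"
    using assms by (auto simp: J_below_def)
  obtain p q where pq: "p \<in> mor" "q \<in> mor" "cd p = dm s" "dm q = cd t" "z = p \<cdot> y \<cdot> q"
    using assms(3) st assms(1) by (auto simp: J_below_def)
  have "z = (p \<cdot> s) \<cdot> x \<cdot> (t \<cdot> q)"
    using st pq assms(1) by (simp add: mult_assoc)
  then show ?thesis
    unfolding J_below_def using st pq
    by (intro bexI[of _ "p \<cdot> s"] bexI[of _ "t \<cdot> q"]) auto
qed

lemma R_below_imp_J_below: "x \<in> mor \<Longrightarrow> R_below y x \<Longrightarrow> J_below y x"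
  using L_below_refl[of x] unfolding R_below_def L_below_def J_below_def by metis

lemma J_below_refl: "x \<in> mor \<Longrightarrow> J_below x x"
  using R_below_refl R_below_imp_J_below by blast

lemma L_below_imp_J_below:
  assumes "x \<in> mor" "L_below y x"
  shows "J_below y x"
proof -
  obtain s t where st: "s \<in> mor" "y = s \<cdot> x" "cd s = dm x" "t \<in> mor" "dm t = cd x" "x = x \<cdot> t"
    using assms R_below_refl[of x] by (auto simp: R_below_def L_below_def)
  then have "y = s \<cdot> x \<cdot> t" using assms by (simp add: mult_assoc)
  then show ?thesis using st by (auto simp: J_below_def)
qed

lemma J_below_mult:
  assumes "x \<in> mor" "s \<in> mor"
  shows "cd s = dm x \<Longrightarrow> J_below (s \<cdot> x) x" and "cd x = dm s \<Longrightarrow> J_below (x \<cdot> s) x"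
  using assms L_below_imp_J_below[of x "s \<cdot> x"] R_below_imp_J_below[of x "x \<cdot> s"]
    L_belowI[of s x] R_belowI[of s x]
  by simp_all

section \<open>Green's relations expressed through the preorders\<close>

lemma right_principal_R_below:
  assumes "x \<in> mor"
  shows "right_principal S x = Inl ` {y. R_below y x}"
  unfolding right_principal_eq[OF psg assms] using R_below_refl[OF assms]
  by (force simp: R_below_def)

lemma left_principal_L_below:
  assumes "x \<in> mor"
  shows "left_principal S x = Inl ` {y. L_below y x}"
  unfolding left_principal_eq[OF psg assms] using L_below_refl[OF assms]
  by (force simp: L_below_def)

lemma Inl_in_principal_iff:
  assumes "x \<in> mor"
  shows "Inl y \<in> principal S x \<longleftrightarrow> J_below y x"
proof -
  have "Inl y \<in> principal S x \<longleftrightarrow> (\<exists>z. L_below z x \<and> z \<in> mor \<and> R_below y z)"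
    unfolding Inl_in_principal[OF psg assms] left_principal_L_below[OF assms]
    by (intro ex_cong1) (auto simp: right_principal_R_below)
  also have "\<dots> \<longleftrightarrow> J_below y x"
  proof
    assume "J_below y x"
    then obtain s t where "s \<in> mor" "t \<in> mor" "cd s = dm x" "dm t = cd x" "y = s \<cdot> x \<cdot> t"
      by (rule J_belowE)
    then show "\<exists>z. L_below z x \<and> z \<in> mor \<and> R_below y z"
      using assms L_belowI[of s x] R_belowI[of t "s \<cdot> x"] by auto
  next
    assume "\<exists>z. L_below z x \<and> z \<in> mor \<and> R_below y z"
    then show "J_below y x"
      using assms by (auto elim!: L_belowE R_belowE intro!: J_belowI)
  qed
  finally show ?thesis .
qed

lemma greenR_iff: "(x, y) \<in> greenR S \<longleftrightarrow> x \<in> mor \<and> y \<in> mor \<and> R_below x y \<and> R_below y x"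
proof (cases "x \<in> mor \<and> y \<in> mor")
  case True
  then have "{z. R_below z x} = {z. R_below z y} \<longleftrightarrow> R_below x y \<and> R_below y x"
    using R_below_refl[of x] R_below_refl[of y] R_below_trans[of x y] R_below_trans[of y x]
    by blast
  then show ?thesis
    using True by (simp add: greenR_def right_principal_R_below inj_image_eq_iff)
qed (auto simp: greenR_def)

lemma greenL_iff: "(x, y) \<in> greenL S \<longleftrightarrow> x \<in> mor \<and> y \<in> mor \<and> L_below x y \<and> L_below y x"
proof (cases "x \<in> mor \<and> y \<in> mor")
  case True
  then have "{z. L_below z x} = {z. L_below z y} \<longleftrightarrow> L_below x y \<and> L_below y x"
    using L_below_refl[of x] L_below_refl[of y] L_below_trans[of x y] L_below_trans[of y x]
    by blast
  then show ?thesis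
    using True by (simp add: greenL_def left_principal_L_below inj_image_eq_iff)
qed (auto simp: greenL_def)

lemma greenJ_iff: "(x, y) \<in> greenJ S \<longleftrightarrow> x \<in> mor \<and> y \<in> mor \<and> J_below x y \<and> J_below y x"
proof (cases "x \<in> mor \<and> y \<in> mor")
  case True
  then have "principal S x \<subseteq> principal S y \<longleftrightarrow> J_below x y"
    "principal S y \<subseteq> principal S x \<longleftrightarrow> J_below y x"
    using principal_trans[OF psg] in_principal_self[OF psg] Inl_in_principal_iff by blast+
  then show ?thesis
    using True by (auto simp: greenJ_def)
qed (auto simp: greenJ_def)

lemma greenH_iff:
  "(x, y) \<in> greenH S \<longleftrightarrow>
     x \<in> mor \<and> y \<in> mor \<and> R_below x y \<and> R_below y x \<and> L_below x y \<and> L_below y x"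
  by (auto simp: greenH_def greenR_iff greenL_iff)

lemma greenH_imp_greenJ: "(x, y) \<in> greenH S \<Longrightarrow> (x, y) \<in> greenJ S"
  using R_below_imp_J_below[of x y] R_below_imp_J_below[of y x]
  by (auto simp: greenH_iff greenJ_iff)

lemma equiv_greenH: "equiv mor (greenH S)"
  by (rule equivI) (auto simp: greenH_def greenR_def greenL_def refl_on_def sym_def trans_def)

lemma R_below_same_dm: "x \<in> mor \<Longrightarrow> R_below y x \<Longrightarrow> dm y = dm x \<and> y \<in> mor"
  by (auto simp: R_below_def)

lemma L_below_same_cd: "x \<in> mor \<Longrightarrow> L_below y x \<Longrightarrow> cd y = cd x \<and> y \<in> mor"
  by (auto simp: L_below_def)

lemma greenH_psim: "(x, y) \<in> greenH S \<Longrightarrow> psim S x y"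
  using R_below_same_dm[of y x] L_below_same_cd[of y x] by (auto simp: greenH_iff psim_def)

text \<open>Together with its dual below, this serves H-related pairs: after multiplication by
  \<open>a\<close> the two products are still J-equivalent, so they stay in a given class or leave
  it together.\<close>

lemma L_below_mult_right:
  assumes "x \<in> mor" "a \<in> mor" "cd x = dm a" "L_below y x"
  shows "L_below (y \<cdot> a) (x \<cdot> a)"
  using assms by (auto simp: L_below_def mult_assoc)

lemma R_below_mult_left:
  assumes "x \<in> mor" "a \<in> mor" "cd a = dm x" "R_below y x"
  shows "R_below (a \<cdot> y) (a \<cdot> x)"
  using assms by (auto simp: R_below_def mult_assoc)

section \<open>Green's relations on an ideal\<close>

context
  fixes I assumes ideal: "is_ideal S I"
begin

lemma ideal_subset: "I \<subseteq> mor"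
  using ideal by (auto simp: is_ideal_def)

lemma ideal_mult: "x \<in> I \<Longrightarrow> s \<in> mor \<Longrightarrow> cd s = dm x \<Longrightarrow> s \<cdot> x \<in> I"
  "x \<in> I \<Longrightarrow> s \<in> mor \<Longrightarrow> cd x = dm s \<Longrightarrow> x \<cdot> s \<in> I"
  using ideal by (auto simp: is_ideal_def)

text \<open>If \<open>x = x \<cdot> a \<cdot> x\<close> then \<open>x \<cdot> s = x \<cdot> (a \<cdot> x \<cdot> s)\<close>, so multipliers may be taken in the ideal.\<close>

lemma right_principal_psub:
  assumes "x \<in> I"
  shows "right_principal (psub S I) x = right_principal S x"
proof -
  have x: "x \<in> mor" using assms ideal_subset by auto
  obtain a where a: "a \<in> mor" "dm a = cd x" "cd a = dm x" "x \<cdot> (a \<cdot> x) = x"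
    using regular_elem[OF x] .
  have "\<exists>s' \<in> I. dm s' = cd x \<and> x \<cdot> s = x \<cdot> s'" if "s \<in> mor" "dm s = cd x" for s
  proof (intro bexI conjI)
    show "a \<cdot> x \<cdot> s \<in> I" "dm (a \<cdot> x \<cdot> s) = cd x"
      using assms that x a ideal_mult by auto
    have "x \<cdot> (a \<cdot> x \<cdot> s) = x \<cdot> (a \<cdot> x) \<cdot> s"
      using x a that mult_assoc[of x "a \<cdot> x" s] by simp
    then show "x \<cdot> s = x \<cdot> (a \<cdot> x \<cdot> s)" using a by simp
  qed
  then show ?thesis
    using right_principal_eq[OF partial_semigroup_psub[OF psg ideal], of x]
      right_principal_eq[OF psg x] ideal_subset assms
    by simp (rule arg_cong[of _ _ "\<lambda>A. insert (Inl x) (Inl ` A)"]; safe; metis subsetD)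
qed

lemma left_principal_psub:
  assumes "x \<in> I"
  shows "left_principal (psub S I) x = left_principal S x"
proof -
  have x: "x \<in> mor" using assms ideal_subset by auto
  obtain a where a: "a \<in> mor" "dm a = cd x" "cd a = dm x" "x \<cdot> (a \<cdot> x) = x"
    using regular_elem[OF x] .
  have "\<exists>s' \<in> I. cd s' = dm x \<and> s \<cdot> x = s' \<cdot> x" if "s \<in> mor" "cd s = dm x" for s
  proof (intro bexI conjI)
    show "s \<cdot> (x \<cdot> a) \<in> I" "cd (s \<cdot> (x \<cdot> a)) = dm x"
      using assms that x a ideal_mult by auto
    show "s \<cdot> x = s \<cdot> (x \<cdot> a) \<cdot> x"
      using x a that by (simp add: mult_assoc)
  qed
  then show ?thesis
    using left_principal_eq[OF partial_semigroup_psub[OF psg ideal], of x]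
      left_principal_eq[OF psg x] ideal_subset assms
    by simp (rule arg_cong[of _ _ "\<lambda>A. insert (Inl x) (Inl ` A)"]; safe; metis subsetD)
qed

text \<open>The intermediate element \<open>z\<close> in \<open>Inl_in_principal\<close> is a left
  multiple of \<open>x \<in> I\<close>, so it lies in \<open>I\<close> and the one-sided results
  apply to it as well.\<close>

lemma Inl_in_principal_psub:
  assumes "x \<in> I"
  shows "Inl y \<in> principal (psub S I) x \<longleftrightarrow> Inl y \<in> principal S x"
proof -
  have x: "x \<in> mor" using assms ideal_subset by auto
  have "z \<in> I" if "Inl z \<in> left_principal S x" for z
    using that assms left_principal_eq[OF psg x] ideal_mult by auto
  then show ?thesis
    using Inl_in_principal[OF partial_semigroup_psub[OF psg ideal], of x y]
      Inl_in_principal[OF psg x, of y] assms left_principal_psub[OF assms] right_principal_psub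
      ideal_subset
    by auto
qed

lemma greenH_psub: "greenH (psub S I) = greenH S \<inter> I \<times> I"
  using right_principal_psub left_principal_psub ideal_subset
  by (auto simp: greenH_def greenR_def greenL_def)

text \<open>Inclusion of principal two-sided ideals amounts to membership of the generator, and
  membership was just compared.\<close>

lemma greenJ_psub: "greenJ (psub S I) = greenJ S \<inter> I \<times> I"
proof -
  have sub: "principal (psub S I) x \<subseteq> principal (psub S I) y \<longleftrightarrow> principal S x \<subseteq> principal S y"
    if "x \<in> I" "y \<in> I" for x y
  proof -
    have "principal (psub S I) x \<subseteq> principal (psub S I) y \<longleftrightarrow> Inl x \<in> principal (psub S I) y"
      using that principal_trans[OF partial_semigroup_psub[OF psg ideal], of x y]
        in_principal_self[OF partial_semigroup_psub[OF psg ideal], of x] by auto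
    also have "\<dots> \<longleftrightarrow> Inl x \<in> principal S y"
      by (rule Inl_in_principal_psub) fact
    also have "\<dots> \<longleftrightarrow> principal S x \<subseteq> principal S y"
      using that ideal_subset principal_trans[OF psg, of x y] in_principal_self[OF psg, of x] by auto
    finally show ?thesis .
  qed
  have "principal (psub S I) x = principal (psub S I) y \<longleftrightarrow> principal S x = principal S y"
    if "x \<in> I" "y \<in> I" for x y
    using sub that by (simp add: set_eq_subset)
  then show ?thesis using ideal_subset by (auto simp: greenJ_def)
qed

end

end

locale stable_regular_partial_semigroup = regular_partial_semigroup +
  assumes stable: "is_stable S"
begin

text \<open>A product is always J-below its factors, so stability asks only for the reverse
  comparison. This is the form in which it is used throughout.\<close>

lemma stableD:
  assumes "x \<in> mor" "a \<in> mor"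
  shows "cd x = dm a \<Longrightarrow> J_below x (x \<cdot> a) \<Longrightarrow> R_below x (x \<cdot> a)"
    and "cd a = dm x \<Longrightarrow> J_below x (a \<cdot> x) \<Longrightarrow> L_below x (a \<cdot> x)"
proof -
  have c: "stable_class S (greenJ S `` {x})" "x \<in> greenJ S `` {x}"
    using stable assms by (auto simp: is_stable_def J_classes_def quotient_def greenJ_def)
  show "R_below x (x \<cdot> a)" if "cd x = dm a" "J_below x (x \<cdot> a)"
  proof -
    have "(x, x \<cdot> a) \<in> greenJ S"
      using that assms
      by (auto simp: greenJ_iff intro!: R_below_imp_J_below) (auto simp: R_below_def)
    then have "(x, x \<cdot> a) \<in> greenR S"
      using c that assms unfolding stable_class_def by blast
    then show ?thesis by (simp add: greenR_iff)
  qed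
  show "L_below x (a \<cdot> x)" if "cd a = dm x" "J_below x (a \<cdot> x)"
  proof -
    have "(x, a \<cdot> x) \<in> greenJ S"
      using that assms
      by (auto simp: greenJ_iff intro!: L_below_imp_J_below) (auto simp: L_below_def)
    then have "(x, a \<cdot> x) \<in> greenL S"
      using c that assms unfolding stable_class_def by blast
    then show ?thesis by (simp add: greenL_iff)
  qed
qed

end

section \<open>Congruences inside the class of a group\<close>

locale H_class_group = stable_regular_partial_semigroup +
  fixes G :: "'a set"
  assumes group_H: "group_H_class S G"
begin

abbreviation e :: 'a where "e \<equiv> \<one>\<^bsub>class_group S G\<^esub>"

lemma carrier_class_group [simp]: "carrier (class_group S G) = G"
  and mult_class_group [simp]: "x \<otimes>\<^bsub>class_group S G\<^esub> y = x \<cdot> y"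
  by (simp_all add: class_group_def)

sublocale grp: group "class_group S G"
  using group_H by (simp add: group_H_class_def)

lemma e_in: "e \<in> G" and e_idem: "e \<cdot> e = e"
  and e_left: "x \<in> G \<Longrightarrow> e \<cdot> x = x" and e_right: "x \<in> G \<Longrightarrow> x \<cdot> e = x"
  using grp.one_closed grp.l_one grp.r_one by auto

text \<open>\<open>G\<close> is given as the H-class of some element; changing the representative to
  the identity turns membership in \<open>G\<close> into divisibility relations with
  \<open>e\<close>.\<close>

lemma in_G_iff: "x \<in> G \<longleftrightarrow> (e, x) \<in> greenH S"
proof -
  have "G \<in> mor // greenH S" using group_H by (simp add: group_H_class_def)
  then obtain z where "G = greenH S `` {z}" by (rule quotientE)
  then have "G = greenH S `` {y}" if "y \<in> G" for y
    using that equiv_class_eq[OF equiv_greenH, of z y] by simp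
  from this[OF e_in] show ?thesis by blast
qed

lemma G_simps:
  assumes "x \<in> G"
  shows "x \<in> mor" "dm x = dm e" "cd x = dm e"
proof -
  have ex: "(e, x) \<in> greenH S" using assms in_G_iff by simp
  moreover have "cd e = dm e" using group_H e_in by (auto simp: group_H_class_def)
  ultimately show "x \<in> mor" "dm x = dm e" "cd x = dm e"
    using greenH_psim[OF ex] by (auto simp: greenH_iff psim_def)
qed

lemma e_simps [simp]: "e \<in> mor" "cd e = dm e"
  using G_simps(1,3)[OF e_in] by auto

lemma G_inverse:
  assumes "x \<in> G"
  obtains x' where "x' \<in> G" "x \<cdot> x' = e" "x' \<cdot> x = e"
  using grp.inv_closed grp.r_inv grp.l_inv assms that by auto

text \<open>A factorization through the idempotent \<open>e\<close>, normalized at \<open>e\<close>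
  on both inner sides. When \<open>c \<cdot> b\<close> lies in the J-class of \<open>e\<close>, the
  elements \<open>c \<cdot> y \<cdot> b\<close> with \<open>y \<in> G\<close> make up its H-class,
  as in Rees matrix coordinates.\<close>

definition factors :: "'a \<Rightarrow> 'a \<Rightarrow> bool" where
  "factors c b \<longleftrightarrow> c \<in> mor \<and> b \<in> mor \<and> cd c = dm e \<and> dm b = dm e \<and> c \<cdot> e = c \<and> e \<cdot> b = b"

text \<open>As \<open>e\<close> is idempotent, \<open>s \<cdot> e \<cdot> t\<close> splits as
  \<open>(s \<cdot> e) \<cdot> (e \<cdot> t)\<close>.\<close>

lemma J_below_e_factors:
  assumes "J_below u e"
  obtains c b where "factors c b" "u = c \<cdot> b"
proof -
  obtain s t where st: "s \<in> mor" "t \<in> mor" "cd s = dm e" "dm t = cd e" "u = s \<cdot> e \<cdot> t"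
    using assms by (rule J_belowE)
  have "u = (s \<cdot> e) \<cdot> (e \<cdot> t)"
    using st e_idem mult_assoc[of "s \<cdot> e" e t] mult_assoc[of s e e] by simp
  moreover have "factors (s \<cdot> e) (e \<cdot> t)"
    using st e_idem mult_assoc[of e e t] mult_assoc[of s e e] by (simp add: factors_def)
  ultimately show ?thesis using that by blast
qed

lemma factors_J_below:
  assumes "factors c b"
  shows "J_below (c \<cdot> b) e"
  using assms J_belowI[of c b e] by (simp add: factors_def)

text \<open>\<open>c = c \<cdot> e\<close> is a left multiple of \<open>e\<close> and, as a factor
  of \<open>c \<cdot> b\<close>, J-above \<open>e\<close>; stability then makes \<open>e\<close> a
  left multiple \<open>s \<cdot> c\<close> of \<open>c\<close>. Replacing \<open>s\<close> by
  \<open>e \<cdot> s\<close> normalizes the inverse. The next lemma is dual.\<close>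

lemma factors_left_inverse:
  assumes "factors c b" "J_below e (c \<cdot> b)"
  obtains c' where "c' \<in> mor" "dm c' = dm e" "cd c' = dm c" "e \<cdot> c' = c'" "c' \<cdot> c = e"
proof -
  have f: "c \<in> mor" "b \<in> mor" "cd c = dm e" "dm b = dm e" "c \<cdot> e = c"
    using assms by (auto simp: factors_def)
  have "J_below e c"
    using f assms(2) J_below_trans[of c "c \<cdot> b" e] J_below_mult(2)[of c b] by simp
  then have "L_below e c"
    using stableD(2)[of e c] f by simp
  then obtain s where s: "s \<in> mor" "cd s = dm c" "s \<cdot> c = e" by (rule L_belowE) (rule that, auto)
  have "dm s = dm e" using mult_simps(2)[of s c] s f by simp
  then show ?thesis
    using s f e_idem that[of "e \<cdot> s"] mult_assoc[of e e s] mult_assoc[of e s c] by simp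
qed

lemma factors_right_inverse:
  assumes "factors c b" "J_below e (c \<cdot> b)"
  obtains b' where "b' \<in> mor" "dm b' = cd b" "cd b' = dm e" "b' \<cdot> e = b'" "b \<cdot> b' = e"
proof -
  have f: "c \<in> mor" "b \<in> mor" "cd c = dm e" "dm b = dm e" "e \<cdot> b = b"
    using assms by (auto simp: factors_def)
  have "J_below e b"
    using f assms(2) J_below_trans[of b "c \<cdot> b" e] J_below_mult(1)[of b c] by simp
  then have "R_below e b"
    using stableD(1)[of e b] f by simp
  then obtain s where s: "s \<in> mor" "dm s = cd b" "b \<cdot> s = e" by (rule R_belowE) (rule that, auto)
  have "cd s = dm e" using mult_simps(3)[of b s] s f by simp
  then show ?thesis
    using s f e_idem that[of "s \<cdot> e"] mult_assoc[of s e e] mult_assoc[of b s e] by simp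
qed

text \<open>The two equations put \<open>h\<close> below \<open>e\<close> on either side; stability
  reverses both comparisons, so \<open>h\<close> is H-related to \<open>e\<close>.\<close>

lemma in_G_I:
  assumes "h \<in> mor" "e \<cdot> h = h" "h \<cdot> e = h" "dm h = dm e" "cd h = dm e" "J_below e h"
  shows "h \<in> G"
proof -
  have "R_below e h" "L_below e h"
    using stableD(1)[of e h] stableD(2)[of e h] assms by auto
  moreover have "R_below h e" "L_below h e"
    using R_belowI[of h e] L_belowI[of h e] assms by auto
  ultimately show ?thesis using assms by (simp add: in_G_iff greenH_iff)
qed

text \<open>Two factorizations of one element of the class differ by a group element passed from one
  factor to the other. This is what makes \<open>nu\<close> independent of the chosen
  factorization.\<close>

lemma factors_unique:
  assumes f: "factors c b" "factors c0 b0" and eq: "c0 \<cdot> b0 = c \<cdot> b" and J: "J_below e (c \<cdot> b)"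
  obtains h k where "h \<in> G" "k \<in> G" "h \<cdot> k = e" "c0 = c \<cdot> h" "b0 = k \<cdot> b"
proof -
  have c: "c \<in> mor" "b \<in> mor" "cd c = dm e" "dm b = dm e" "c \<cdot> e = c" "e \<cdot> b = b"
    and c0: "c0 \<in> mor" "b0 \<in> mor" "cd c0 = dm e" "dm b0 = dm e" "c0 \<cdot> e = c0" "e \<cdot> b0 = b0"
    using f by (auto simp: factors_def)
  have J0: "J_below e (c0 \<cdot> b0)" using J eq by simp
  have same: "dm c0 = dm c" "cd b0 = cd b"
    using eq c c0 mult_simps(2,3)[of c b] mult_simps(2,3)[of c0 b0] by simp_all
  obtain b0' where b0': "b0' \<in> mor" "dm b0' = cd b0" "cd b0' = dm e" "b0' \<cdot> e = b0'" "b0 \<cdot> b0' = e"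
    using factors_right_inverse[OF f(2) J0] .
  obtain c0' where c0': "c0' \<in> mor" "dm c0' = dm e" "cd c0' = dm c0" "e \<cdot> c0' = c0'" "c0' \<cdot> c0 = e"
    using factors_left_inverse[OF f(2) J0] .
  \<comment> \<open>The choice is forced: multiplying \<open>c0 \<cdot> b0 = c \<cdot> b\<close> by
    \<open>b0'\<close> on the right gives \<open>c0 = c \<cdot> (b \<cdot> b0')\<close>, and by
    \<open>c0'\<close> on the left gives \<open>b0 = (c0' \<cdot> c) \<cdot> b\<close>.\<close>
  define h k where "h = b \<cdot> b0'" and "k = c0' \<cdot> c"
  note ty = c c0 b0' c0' same
  have ch: "c \<cdot> h = c0"
    unfolding h_def using ty eq mult_assoc[of c b b0'] mult_assoc[of c0 b0 b0'] by simp
  have kb: "k \<cdot> b = b0"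
    unfolding k_def using ty eq mult_assoc[of c0' c b] mult_assoc[of c0' c0 b0] by simp
  have h: "h \<in> mor" "dm h = dm e" "cd h = dm e" "e \<cdot> h = h" "h \<cdot> e = h"
    unfolding h_def using ty mult_assoc[of e b b0'] mult_assoc[of b b0' e] by auto
  have k: "k \<in> mor" "dm k = dm e" "cd k = dm e" "e \<cdot> k = k" "k \<cdot> e = k"
    unfolding k_def using ty mult_assoc[of e c0' c] mult_assoc[of c0' c e] by auto
  have kh: "k \<cdot> h = e"
    using ch ty h mult_assoc[of c0' c h] by (simp add: k_def)
  \<comment> \<open>\<open>k \<cdot> h = e\<close> places \<open>e\<close> below both elements,
    hence both in \<open>G\<close>; in a group a one-sided inverse is two-sided, which yields
    \<open>h \<cdot> k = e\<close>.\<close>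
  have "J_below e h" "J_below e k"
    using J_below_mult(1)[of h k] J_below_mult(2)[of k h] h k kh by auto
  then have G: "h \<in> G" "k \<in> G" using in_G_I h k by auto
  have "h \<cdot> k = e"
    using grp.inv_comm[of k h] G kh by simp
  then show ?thesis using that[OF G] ch kb by simp
qed

text \<open>\<open>nu_rel\<close> in normal form: the first element of \<open>N\<close> is
  \<open>e\<close> and the multipliers are ordinary elements normalized at \<open>e\<close>. Since
  \<open>c \<cdot> b\<close> is always J-below \<open>e\<close>, the last condition places it in the
  J-class of \<open>e\<close>. Agreement with \<open>nu_rel\<close> is
  \<open>nu_rel_eq_nu\<close>.\<close>

definition nu :: "'a set \<Rightarrow> 'a rel" where
  "nu N = {(c \<cdot> b, c \<cdot> y \<cdot> b) | c b y. factors c b \<and> y \<in> N \<and> J_below e (c \<cdot> b)}"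

lemma factors_G_mult:
  assumes f: "factors c b" and y: "y \<in> G" and y': "y' \<in> G"
  shows "factors (c \<cdot> y) b" "c \<cdot> y \<cdot> y' = c \<cdot> (y \<cdot> y')"
  using assms G_simps[OF y] G_simps[OF y'] mult_assoc[of c y e] mult_assoc[of c y y'] e_right[OF y]
  by (auto simp: factors_def)

text \<open>With one-sided inverses \<open>c'\<close> and \<open>b'\<close> of the factors,
  \<open>c \<cdot> y \<cdot> b\<close> equals both
  \<open>(c \<cdot> b) \<cdot> (b' \<cdot> (y \<cdot> b))\<close> and
  \<open>(c \<cdot> y \<cdot> c') \<cdot> (c \<cdot> b)\<close>. The reverse comparisons are the
  same facts for the factorization \<open>(c \<cdot> y) \<cdot> b\<close> and the inverse of
  \<open>y\<close>.\<close>

lemma factors_G_greenH: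
  assumes f: "factors c b" and J: "J_below e (c \<cdot> b)" and y: "y \<in> G"
  shows "(c \<cdot> b, c \<cdot> y \<cdot> b) \<in> greenH S"
proof -
  have below: "R_below (c \<cdot> z \<cdot> b) (c \<cdot> b)" "L_below (c \<cdot> z \<cdot> b) (c \<cdot> b)"
    if f: "factors c b" and J: "J_below e (c \<cdot> b)" and z: "z \<in> G" for c b z
  proof -
    obtain b' where b': "b' \<in> mor" "dm b' = cd b" "cd b' = dm e" "b' \<cdot> e = b'" "b \<cdot> b' = e"
      using factors_right_inverse[OF f J] .
    obtain c' where c': "c' \<in> mor" "dm c' = dm e" "cd c' = dm c" "e \<cdot> c' = c'" "c' \<cdot> c = e"
      using factors_left_inverse[OF f J] .
    have c: "c \<in> mor" "b \<in> mor" "cd c = dm e" "dm b = dm e" "c \<cdot> e = c" "e \<cdot> b = b"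
      using f by (auto simp: factors_def)
    note z = G_simps[OF z] e_left[OF z] e_right[OF z]
    have "b \<cdot> (b' \<cdot> (z \<cdot> b)) = z \<cdot> b"
      using c b' z mult_assoc[of b b' "z \<cdot> b"] mult_assoc[of e z b] by simp
    then have "c \<cdot> z \<cdot> b = (c \<cdot> b) \<cdot> (b' \<cdot> (z \<cdot> b))"
      using c b' z by (simp add: mult_assoc)
    then show "R_below (c \<cdot> z \<cdot> b) (c \<cdot> b)"
      using R_belowI[of "b' \<cdot> (z \<cdot> b)" "c \<cdot> b"] c b' z by simp
    have "c \<cdot> z \<cdot> c' \<cdot> c = c \<cdot> z"
      using c c' z by (simp add: mult_assoc)
    then have "c \<cdot> z \<cdot> b = (c \<cdot> z \<cdot> c') \<cdot> (c \<cdot> b)"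
      using c c' z mult_assoc[of "c \<cdot> z \<cdot> c'" c b] by simp
    then show "L_below (c \<cdot> z \<cdot> b) (c \<cdot> b)"
      using L_belowI[of "c \<cdot> z \<cdot> c'" "c \<cdot> b"] c c' z by simp
  qed
  obtain y' where y': "y' \<in> G" "y \<cdot> y' = e" "y' \<cdot> y = e" using G_inverse[OF y] .
  note ty = G_simps[OF y] G_simps[OF y'(1)]
  have c: "c \<in> mor" "b \<in> mor" "cd c = dm e" "dm b = dm e" "c \<cdot> e = c" "e \<cdot> b = b"
    using f by (auto simp: factors_def)
  have cancel: "(c \<cdot> y) \<cdot> y' \<cdot> b = c \<cdot> b"
    using factors_G_mult(2)[OF f y y'(1)] y' c by simp
  \<comment> \<open>The second factorization must also lie in the class: multiplying by
    \<open>c'\<close> on the left and \<open>b' \<cdot> y'\<close> on the right recovers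
    \<open>e\<close>.\<close>
  have "J_below e (c \<cdot> y \<cdot> b)"
  proof -
    obtain b' where b': "b' \<in> mor" "dm b' = cd b" "cd b' = dm e" "b' \<cdot> e = b'" "b \<cdot> b' = e"
      using factors_right_inverse[OF f J] .
    obtain c' where c': "c' \<in> mor" "dm c' = dm e" "cd c' = dm c" "e \<cdot> c' = c'" "c' \<cdot> c = e"
      using factors_left_inverse[OF f J] .
    have 1: "c' \<cdot> (c \<cdot> y \<cdot> b) = y \<cdot> b"
      using c c' ty mult_assoc[of c' "c \<cdot> y" b] mult_assoc[of c' c y] e_left[OF y] by simp
    have 2: "y \<cdot> b \<cdot> (b' \<cdot> y') = e"
      using c b' ty y' mult_assoc[of y b "b' \<cdot> y'"] mult_assoc[of b b' y'] e_left[OF y'(1)] by simp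
    have "J_below (c' \<cdot> (c \<cdot> y \<cdot> b) \<cdot> (b' \<cdot> y')) (c \<cdot> y \<cdot> b)"
      by (rule J_belowI) (use c c' b' ty in simp_all)
    then show ?thesis by (simp only: 1 2)
  qed
  then have "R_below (c \<cdot> b) (c \<cdot> y \<cdot> b)" "L_below (c \<cdot> b) (c \<cdot> y \<cdot> b)"
    using below[OF factors_G_mult(1)[OF f y y'(1)] _ y'(1)] cancel by auto
  then show ?thesis
    using below[OF f J y] c ty by (simp add: greenH_iff)
qed

text \<open>The multiplier is absorbed into the outer factor, \<open>b \<cdot> a\<close> or
  \<open>a \<cdot> c\<close>, and the same \<open>y\<close> still works. Products that drop out of
  the class are treated in \<open>Rees_normal_Cong\<close>.\<close>

lemma nu_mult:
  assumes uv: "(u, v) \<in> nu N" and N: "N \<subseteq> G" and a: "a \<in> mor"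
  shows "cd u = dm a \<Longrightarrow> J_below e (u \<cdot> a) \<Longrightarrow> (u \<cdot> a, v \<cdot> a) \<in> nu N"
    and "cd a = dm u \<Longrightarrow> J_below e (a \<cdot> u) \<Longrightarrow> (a \<cdot> u, a \<cdot> v) \<in> nu N"
proof -
  obtain c b y where f: "factors c b" and y: "y \<in> N" and u: "u = c \<cdot> b" and v: "v = c \<cdot> y \<cdot> b"
    using uv by (auto simp: nu_def)
  have c: "c \<in> mor" "b \<in> mor" "cd c = dm e" "dm b = dm e" "c \<cdot> e = c" "e \<cdot> b = b"
    using f by (auto simp: factors_def)
  note ty = c G_simps[OF subsetD[OF N y]] a
  show "(u \<cdot> a, v \<cdot> a) \<in> nu N" if "cd u = dm a" "J_below e (u \<cdot> a)"
  proof -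
    have da: "cd b = dm a" using that u c by simp
    have "u \<cdot> a = c \<cdot> (b \<cdot> a)" "v \<cdot> a = c \<cdot> y \<cdot> (b \<cdot> a)"
      unfolding u v using ty da by (simp_all add: mult_assoc)
    moreover have "factors c (b \<cdot> a)"
      using ty da mult_assoc[of e b a] by (simp add: factors_def)
    ultimately show ?thesis using that y by (auto simp: nu_def)
  qed
  show "(a \<cdot> u, a \<cdot> v) \<in> nu N" if "cd a = dm u" "J_below e (a \<cdot> u)"
  proof -
    have da: "cd a = dm c" using that u c by simp
    have "a \<cdot> u = a \<cdot> c \<cdot> b" "a \<cdot> v = a \<cdot> c \<cdot> y \<cdot> b"
      unfolding u v using ty da by (simp_all add: mult_assoc)
    moreover have "factors (a \<cdot> c) b"
      using ty da mult_assoc[of a c e] by (simp add: factors_def)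
    ultimately show ?thesis using that y by (auto simp: nu_def)
  qed
qed

section \<open>The relation of a normal subgroup\<close>

context
  fixes N assumes N: "N \<lhd> class_group S G"
begin

lemma normal_subset: "N \<subseteq> G"
  using subgroup.subset[OF normal_imp_subgroup[OF N]] by simp

lemma normal_conj:
  assumes "y \<in> N" "h \<in> G" "k \<in> G" "h \<cdot> k = e"
  shows "h \<cdot> y \<cdot> k \<in> N"
proof -
  have "k = inv\<^bsub>class_group S G\<^esub> h"
    using assms grp.inv_equality[of k h] grp.inv_comm[of h k] by simp
  then show ?thesis
    using normal.inv_op_closed2[OF N, of h y] assms by simp
qed

lemma nu_subset_greenH: "nu N \<subseteq> greenH S"
  using factors_G_greenH normal_subset by (auto simp: nu_def)

text \<open>Here normality enters: changing the factorization replaces \<open>y\<close> by its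
  conjugate \<open>h \<cdot> y \<cdot> k\<close>, which is again in \<open>N\<close>. So a pair may
  be read off from any factorization of its first element.\<close>

lemma nu_refactor:
  assumes uv: "(u, v) \<in> nu N" and f: "factors c b" and u: "u = c \<cdot> b"
  obtains y where "y \<in> N" "v = c \<cdot> y \<cdot> b"
proof -
  obtain c0 b0 y where f0: "factors c0 b0" and y: "y \<in> N" and u0: "u = c0 \<cdot> b0" and v: "v = c0 \<cdot> y \<cdot> b0"
    and J: "J_below e u"
    using uv by (auto simp: nu_def)
  obtain h k where hk: "h \<in> G" "k \<in> G" "h \<cdot> k = e" "c0 = c \<cdot> h" "b0 = k \<cdot> b"
    using factors_unique[OF f f0] u u0 J by metis
  have yG: "y \<in> G" using y normal_subset by auto
  have c: "c \<in> mor" "b \<in> mor" "cd c = dm e" "dm b = dm e"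
    using f by (auto simp: factors_def)
  have "v = c \<cdot> (h \<cdot> y \<cdot> k) \<cdot> b"
    unfolding v hk(4,5) using c G_simps[OF hk(1)] G_simps[OF hk(2)] G_simps[OF yG]
    by (simp add: mult_assoc)
  then show ?thesis using that normal_conj[OF y hk(1-3)] by blast
qed

text \<open>Reflexivity, symmetry and transitivity come from \<open>e\<close>, inverses and products
  in \<open>N\<close>. For transitivity the second pair is first rewritten over the factorization
  \<open>(c \<cdot> y) \<cdot> b\<close> of the common element.\<close>

lemma equiv_nu: "equiv (greenJ S `` {e}) (nu N)"
proof (rule equivI)
  have J: "greenJ S `` {e} = {u \<in> mor. J_below u e \<and> J_below e u}"
    by (auto simp: greenJ_iff)
  show "nu N \<subseteq> greenJ S `` {e} \<times> greenJ S `` {e}"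
  proof (rule subrelI)
    fix u v assume uv: "(u, v) \<in> nu N"
    then have 1: "(e, u) \<in> greenJ S"
      using factors_J_below by (auto simp: nu_def greenJ_iff) (auto simp: factors_def)
    moreover have "(u, v) \<in> greenJ S"
      using uv nu_subset_greenH greenH_imp_greenJ by blast
    ultimately show "(u, v) \<in> greenJ S `` {e} \<times> greenJ S `` {e}"
      using equiv_greenJ[of S] by (auto dest: equivE transD)
  qed
  show "refl_on (greenJ S `` {e}) (nu N)"
  proof (rule refl_onI)
    fix u assume u: "u \<in> greenJ S `` {e}"
    then obtain c b where f: "factors c b" "u = c \<cdot> b"
      using J_below_e_factors by (auto simp: J)
    moreover have "e \<in> N"
      using subgroup.one_closed[OF normal_imp_subgroup[OF N]] .
    moreover have "c \<cdot> e \<cdot> b = u" using f by (simp add: factors_def)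
    ultimately show "(u, u) \<in> nu N"
      using u unfolding nu_def J by (force simp: factors_def)
  qed
  show "sym (nu N)"
  proof (rule symI)
    fix u v assume uv: "(u, v) \<in> nu N"
    then obtain c b y where f: "factors c b" "y \<in> N" "u = c \<cdot> b" "v = c \<cdot> y \<cdot> b" "J_below e u"
      by (auto simp: nu_def)
    have yG: "y \<in> G" using f normal_subset by auto
    define y' where "y' = inv\<^bsub>class_group S G\<^esub> y"
    have y': "y' \<in> N" "y \<cdot> y' = e"
      using f(2) yG grp.r_inv[of y] subgroup.m_inv_closed[OF normal_imp_subgroup[OF N]]
      by (auto simp: y'_def)
    have y'G: "y' \<in> G" using y' normal_subset by auto
    have "u = c \<cdot> y \<cdot> y' \<cdot> b"
      using f y' factors_G_mult(2)[OF f(1) yG y'G] by (simp add: factors_def)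
    moreover have "J_below e v"
    proof -
      have "(u, v) \<in> greenJ S"
        using uv nu_subset_greenH greenH_imp_greenJ by blast
      then show ?thesis using f(5) J_below_trans[of v u e] by (simp add: greenJ_iff)
    qed
    ultimately show "(v, u) \<in> nu N"
      using f(4) y'(1) factors_G_mult(1)[OF f(1) yG yG] unfolding nu_def by blast
  qed
  show "trans (nu N)"
  proof (rule transI)
    fix u v w assume uv: "(u, v) \<in> nu N" and vw: "(v, w) \<in> nu N"
    then obtain c b y where f: "factors c b" "y \<in> N" "u = c \<cdot> b" "v = c \<cdot> y \<cdot> b" "J_below e u"
      by (auto simp: nu_def)
    have yG: "y \<in> G" using f normal_subset by auto
    obtain z where z: "z \<in> N" "w = c \<cdot> y \<cdot> z \<cdot> b"
      using nu_refactor[OF vw factors_G_mult(1)[OF f(1) yG yG] f(4)] .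
    then have "w = c \<cdot> (y \<cdot> z) \<cdot> b"
      using factors_G_mult(2)[OF f(1) yG, of z] normal_subset by auto
    moreover have "y \<cdot> z \<in> N"
      using subgroup.m_closed[OF normal_imp_subgroup[OF N] f(2) z(1)] by simp
    ultimately show "(u, w) \<in> nu N"
      using f unfolding nu_def by blast
  qed
qed

end

abbreviation Jcl :: "'a set" where "Jcl \<equiv> greenJ S `` {e}"

lemma Jcl_iff: "u \<in> Jcl \<longleftrightarrow> u \<in> mor \<and> J_below u e \<and> J_below e u"
  by (auto simp: greenJ_iff)

lemma e_Jcl: "e \<in> Jcl"
  using J_below_refl[of e] by (simp add: greenJ_iff)

text \<open>Multiplying by \<open>e\<close> on the inner side turns the multipliers of
  \<open>nu_rel\<close> into a factorization. Conversely, normalized factors are multiples of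
  \<open>e \<in> X\<close>, so they lie in the ideal \<open>X\<close> and are admissible multipliers
  there.\<close>

lemma nu_rel_eq_nu:
  assumes N: "N \<lhd> class_group S G" and X: "is_ideal S X" "e \<in> X"
  shows "nu_rel (psub S X) Jcl N = nu N"
proof
  have NG: "N \<subseteq> G" by (rule normal_subset[OF N])
  show "nu_rel (psub S X) Jcl N \<subseteq> nu N"
  proof (rule subrelI)
    fix u v assume "(u, v) \<in> nu_rel (psub S X) Jcl N"
    then obtain x y a b where uv: "u \<in> Jcl" "v \<in> Jcl" and xy: "x \<in> N" "y \<in> N"
      and ab: "a \<in> pmor (adj1 (psub S X))" "b \<in> pmor (adj1 (psub S X))"
        "pcod (adj1 (psub S X)) a = dm x" "cd x = pdom (adj1 (psub S X)) b"
      and u: "Inl u = pmult (adj1 (psub S X)) (pmult (adj1 (psub S X)) a (Inl x)) b"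
      and v: "Inl v = pmult (adj1 (psub S X)) (pmult (adj1 (psub S X)) a (Inl y)) b"
      unfolding nu_rel_def by auto
    have xyG: "x \<in> G" "y \<in> G" using xy NG by auto
    have Xm: "X \<subseteq> mor" using X by (auto simp: is_ideal_def)
    \<comment> \<open>On \<open>G\<close> the multiplier \<open>Inl s\<close> acts as
      \<open>s \<cdot> e\<close>, and an adjoined identity acts as \<open>e\<close>; the right
      multiplier \<open>b\<close> is treated likewise.\<close>
    obtain a' where a': "a' \<in> mor" "cd a' = dm e" "a' \<cdot> e = a'"
      "\<And>z. z \<in> G \<Longrightarrow> pmult (adj1 (psub S X)) a (Inl z) = Inl (a' \<cdot> z)"
    proof (cases a)
      case (Inl s)
      then have "s \<in> mor" "cd s = dm e" using ab G_simps[OF xyG(1)] Xm by auto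
      then show ?thesis
        using that[of "s \<cdot> e"] Inl e_idem e_left G_simps by (auto simp: mult_assoc)
    next
      case (Inr c)
      then show ?thesis using that[of e] e_idem e_left by auto
    qed
    obtain b' where b': "b' \<in> mor" "dm b' = dm e" "e \<cdot> b' = b'"
      "\<And>w. w \<in> mor \<Longrightarrow> cd w = dm e \<Longrightarrow> w \<cdot> e = w \<Longrightarrow> pmult (adj1 (psub S X)) (Inl w) b = Inl (w \<cdot> b')"
    proof (cases b)
      case (Inl s)
      then have s: "s \<in> mor" "dm s = dm e" using ab G_simps[OF xyG(1)] Xm by auto
      have "e \<cdot> (e \<cdot> s) = e \<cdot> s" using s e_idem mult_assoc[of e e s] by simp
      moreover have "w \<cdot> (e \<cdot> s) = w \<cdot> s" if "w \<in> mor" "cd w = dm e" "w \<cdot> e = w" for w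
        using s that mult_assoc[of w e s] by simp
      ultimately show ?thesis
        using that[of "e \<cdot> s"] Inl s by simp
    next
      case (Inr c)
      then show ?thesis using that[of e] e_idem by auto
    qed
    have w: "a' \<cdot> z \<in> mor" "cd (a' \<cdot> z) = dm e" "a' \<cdot> z \<cdot> e = a' \<cdot> z" if "z \<in> G" for z
      using that a' G_simps[OF that] e_right[OF that] by (auto simp: mult_assoc)
    have u': "u = a' \<cdot> x \<cdot> b'" and v': "v = a' \<cdot> y \<cdot> b'"
      using u v a'(4)[OF xyG(1)] a'(4)[OF xyG(2)] b'(4)[OF w[OF xyG(1)]] b'(4)[OF w[OF xyG(2)]]
      by auto
    have f: "factors a' b'" using a' b' by (simp add: factors_def)
    \<comment> \<open>To start the pair at \<open>e\<close>, \<open>x\<close> is absorbed on the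
      left: over the factorization \<open>(a' \<cdot> x) \<cdot> b'\<close> the pair is given by
      \<open>x' \<cdot> y\<close>, where \<open>x'\<close> inverts \<open>x\<close>.\<close>
    obtain x' where x': "x' \<in> G" "x \<cdot> x' = e" "x' \<in> N"
      using xy(1) xyG(1) grp.r_inv[of x] subgroup.m_inv_closed[OF normal_imp_subgroup[OF N], of x] NG
      by auto
    have z: "x' \<cdot> y \<in> N"
      using subgroup.m_closed[OF normal_imp_subgroup[OF N] x'(3) xy(2)] by simp
    have "x \<cdot> (x' \<cdot> y) = y"
      using x' xyG G_simps mult_assoc[of x x' y] e_left[of y] by simp
    then have "v = a' \<cdot> x \<cdot> (x' \<cdot> y) \<cdot> b'"
      using factors_G_mult(2)[OF f xyG(1), of "x' \<cdot> y"] z NG v' by auto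
    moreover have "J_below e u" using uv by (simp add: greenJ_iff)
    ultimately show "(u, v) \<in> nu N"
      using factors_G_mult(1)[OF f xyG(1) xyG(1)] z u' unfolding nu_def by blast
  qed
  show "nu N \<subseteq> nu_rel (psub S X) Jcl N"
  proof (rule subrelI)
    fix u v assume uv: "(u, v) \<in> nu N"
    then have "u \<in> Jcl" "v \<in> Jcl" using equiv_nu[OF N] by (auto simp: equiv_def)
    obtain c b y where f: "factors c b" and y: "y \<in> N" and u: "u = c \<cdot> b" and v: "v = c \<cdot> y \<cdot> b"
      using uv by (auto simp: nu_def)
    have c: "c \<in> mor" "b \<in> mor" "cd c = dm e" "dm b = dm e" "c \<cdot> e = c" "e \<cdot> b = b"
      using f by (auto simp: factors_def)
    have "c \<in> X" "b \<in> X"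
      using ideal_mult(1)[OF X(1,2), of c] ideal_mult(2)[OF X(1,2), of b] c by auto
    moreover have "e \<in> N"
      using subgroup.one_closed[OF normal_imp_subgroup[OF N]] .
    moreover have "dm y = dm e" "cd y = dm e" using G_simps y NG by auto
    ultimately show "(u, v) \<in> nu_rel (psub S X) Jcl N"
      unfolding nu_rel_def using \<open>u \<in> Jcl\<close> \<open>v \<in> Jcl\<close> y u v c
      by (intro CollectI case_prodI conjI bexI[of _ e] bexI[of _ y] bexI[of _ "Inl c"]
          bexI[of _ "Inl b"]) simp_all
  qed
qed

text \<open>A product of a pair in \<open>nu N\<close> either stays in the class, where
  \<open>nu_mult\<close> applies, or falls out of it. In the latter case both products do so, since
  the pair is H-related; they land in \<open>I\<close>, and all parallel elements of
  \<open>I\<close> are related.\<close>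

lemma Rees_normal_Cong:
  assumes N: "N \<lhd> class_group S G"
    and I: "is_ideal S I" "is_ideal S (I \<union> Jcl)" "I \<inter> Jcl = {}"
    and X: "is_ideal S X" "I \<union> Jcl \<subseteq> X"
  shows "Rees_normal_cong (psub S X) I Jcl N \<in> Cong (psub S X)"
proof -
  have eX: "e \<in> X" using X(2) e_Jcl by blast
  have eq: "Rees_normal_cong (psub S X) I Jcl N = nabla (psub S I) \<union> Id_on X \<union> nu N"
    by (simp add: Rees_normal_cong_def Rees_cong_def nu_rel_eq_nu[OF N X(1) eX])
  have nuJ: "u \<in> Jcl \<and> v \<in> Jcl" if "(u, v) \<in> nu N" for u v
    using that equiv_nu[OF N] by (auto simp: equiv_def)
  have Xm: "X \<subseteq> mor" using X by (auto simp: is_ideal_def)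
  have mult: "(u \<cdot> a, v \<cdot> a) \<in> nabla (psub S I) \<union> nu N" if uv: "(u, v) \<in> nu N" and a: "a \<in> mor" "dm a = cd u"
    for u v a
  proof (cases "J_below e (u \<cdot> a)")
    case True
    then show ?thesis using nu_mult(1)[OF uv normal_subset[OF N]] a by auto
  next
    case False
    have H: "(u, v) \<in> greenH S" using nu_subset_greenH[OF N] uv by blast
    then have m: "u \<in> mor" "v \<in> mor" "cd v = cd u" "dm v = dm u"
      using greenH_psim[OF H] by (auto simp: greenH_iff psim_def)
    have "J_below (u \<cdot> a) (v \<cdot> a)"
      using L_below_mult_right[of v a u] L_below_imp_J_below H m a by (simp add: greenH_iff)
    moreover have "J_below (v \<cdot> a) (u \<cdot> a)"
      using L_below_mult_right[of u a v] L_below_imp_J_below H m a by (simp add: greenH_iff)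
    ultimately have "\<not> J_below e (v \<cdot> a)"
      using False J_below_trans[of "u \<cdot> a" "v \<cdot> a" e] m a by auto
    then have "u \<cdot> a \<in> I" "v \<cdot> a \<in> I"
      using ideal_mult(2)[OF I(2), of u a] ideal_mult(2)[OF I(2), of v a] nuJ[OF uv] False a m
      by (auto simp: greenJ_iff)
    then show ?thesis using m a by (simp add: psim_def)
  qed
  have mult': "(a \<cdot> u, a \<cdot> v) \<in> nabla (psub S I) \<union> nu N" if uv: "(u, v) \<in> nu N" and a: "a \<in> mor" "cd a = dm u"
    for u v a
  proof (cases "J_below e (a \<cdot> u)")
    case True
    then show ?thesis using nu_mult(2)[OF uv normal_subset[OF N]] a by auto
  next
    case False
    have H: "(u, v) \<in> greenH S" using nu_subset_greenH[OF N] uv by blast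
    then have m: "u \<in> mor" "v \<in> mor" "cd v = cd u" "dm v = dm u"
      using greenH_psim[OF H] by (auto simp: greenH_iff psim_def)
    have "J_below (a \<cdot> u) (a \<cdot> v)"
      using R_below_mult_left[of v a u] R_below_imp_J_below H m a by (simp add: greenH_iff)
    moreover have "J_below (a \<cdot> v) (a \<cdot> u)"
      using R_below_mult_left[of u a v] R_below_imp_J_below H m a by (simp add: greenH_iff)
    ultimately have "\<not> J_below e (a \<cdot> v)"
      using False J_below_trans[of "a \<cdot> u" "a \<cdot> v" e] m a by auto
    then have "a \<cdot> u \<in> I" "a \<cdot> v \<in> I"
      using ideal_mult(1)[OF I(2), of u a] ideal_mult(1)[OF I(2), of v a] nuJ[OF uv] False a m
      by (auto simp: greenJ_iff)
    then show ?thesis using m a by (simp add: psim_def)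
  qed
  have Im: "I \<subseteq> mor" using I by (auto simp: is_ideal_def)
  show ?thesis unfolding eq
  proof (rule CongI)
    show "equiv (pmor (psub S X)) (nabla (psub S I) \<union> Id_on X \<union> nu N)"
      using equiv_disjoint_union_Id_on[OF equiv_nabla[of "psub S I"] equiv_nu[OF N]] I(3) X(2) by simp
    show "psim (psub S X) x y" if "(x, y) \<in> nabla (psub S I) \<union> Id_on X \<union> nu N" for x y
      using that nu_subset_greenH[OF N] greenH_psim by (auto simp: psim_def)
  next
    fix x y a
    assume xy: "(x, y) \<in> nabla (psub S I) \<union> Id_on X \<union> nu N" and a: "a \<in> pmor (psub S X)"
    show "(pmult (psub S X) a x, pmult (psub S X) a y) \<in> nabla (psub S I) \<union> Id_on X \<union> nu N"
      if "pcod (psub S X) a = pdom (psub S X) x"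
    proof -
      consider "x \<in> I" "y \<in> I" "psim S x y" | "x = y" "x \<in> X" | "(x, y) \<in> nu N"
        using xy by auto
      then show ?thesis
      proof cases
        case 1
        then have "x \<in> mor" "y \<in> mor" "a \<in> mor" using a Xm Im by auto
        then show ?thesis
          using 1 ideal_mult(1)[OF I(1), of x a] ideal_mult(1)[OF I(1), of y a] that
          by (auto simp: psim_def)
      next
        case 2
        then show ?thesis using ideal_mult(1)[OF X(1), of x a] a that Xm by auto
      next
        case 3
        then show ?thesis using mult'[of x y a] a that Xm by auto
      qed
    qed
    show "(pmult (psub S X) x a, pmult (psub S X) y a) \<in> nabla (psub S I) \<union> Id_on X \<union> nu N"
      if "pdom (psub S X) a = pcod (psub S X) x"
    proof -
      consider "x \<in> I" "y \<in> I" "psim S x y" | "x = y" "x \<in> X" | "(x, y) \<in> nu N"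
        using xy by auto
      then show ?thesis
      proof cases
        case 1
        then have "x \<in> mor" "y \<in> mor" "a \<in> mor" using a Xm Im by auto
        then show ?thesis
          using 1 ideal_mult(2)[OF I(1), of x a] ideal_mult(2)[OF I(1), of y a] that
          by (auto simp: psim_def)
      next
        case 2
        then show ?thesis using ideal_mult(2)[OF X(1), of x a] a that Xm by auto
      next
        case 3
        then show ?thesis using mult[of x y a] a that Xm by auto
      qed
    qed
  qed
qed

section \<open>The normal subgroup attached to a congruence\<close>

context
  fixes X \<sigma>
  assumes X: "is_ideal S X" "Jcl \<subseteq> X" and \<sigma>: "\<sigma> \<in> Cong (psub S X)"
begin

lemma G_subset_ideal: "G \<subseteq> X"
  using X(2) greenH_imp_greenJ in_G_iff by blast

text \<open>\<open>\<sigma>\<close> restricts to a congruence of the group \<open>G\<close>, and the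
  class of the identity under a group congruence is a normal subgroup.\<close>

lemma Cong_kernel_normal: "{y \<in> G. (e, y) \<in> \<sigma>} \<lhd> class_group S G"
proof -
  have e: "e \<in> G" "e \<in> X" using e_in G_subset_ideal by auto
  have left: "(h \<cdot> x, h \<cdot> y) \<in> \<sigma>" and right: "(x \<cdot> h, y \<cdot> h) \<in> \<sigma>"
    if "(x, y) \<in> \<sigma>" "h \<in> G" "x \<in> G" for x y h
    using Cong_left[OF \<sigma> that(1), of h] Cong_right[OF \<sigma> that(1), of h] that(2) G_subset_ideal
      G_simps[OF that(2)] G_simps[OF that(3)] by auto
  have "subgroup {y \<in> G. (e, y) \<in> \<sigma>} (class_group S G)"
  proof (rule subgroup.intro)
    show "{y \<in> G. (e, y) \<in> \<sigma>} \<subseteq> carrier (class_group S G)" by auto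
    show "e \<in> {y \<in> G. (e, y) \<in> \<sigma>}" using e Cong_refl[OF \<sigma>] by simp
  next
    fix x y assume "x \<in> {y \<in> G. (e, y) \<in> \<sigma>}" "y \<in> {y \<in> G. (e, y) \<in> \<sigma>}"
    then show "x \<otimes>\<^bsub>class_group S G\<^esub> y \<in> {y \<in> G. (e, y) \<in> \<sigma>}"
      using left[of e y x] e Cong_trans[OF \<sigma>, of e x "x \<cdot> y"] grp.m_closed[of x y] e_right[of x] by simp
  next
    fix x assume "x \<in> {y \<in> G. (e, y) \<in> \<sigma>}"
    then show "inv\<^bsub>class_group S G\<^esub> x \<in> {y \<in> G. (e, y) \<in> \<sigma>}"
      using left[of e x "inv\<^bsub>class_group S G\<^esub> x"] e grp.inv_closed[of x] grp.l_inv[of x]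
        e_right[of "inv\<^bsub>class_group S G\<^esub> x"] Cong_sym[OF \<sigma>] by simp
  qed
  moreover have "h \<cdot> y \<cdot> inv\<^bsub>class_group S G\<^esub> h \<in> G \<and> (e, h \<cdot> y \<cdot> inv\<^bsub>class_group S G\<^esub> h) \<in> \<sigma>"
    if "h \<in> G" "y \<in> G" "(e, y) \<in> \<sigma>" for h y
  proof -
    have i: "inv\<^bsub>class_group S G\<^esub> h \<in> G" "h \<cdot> inv\<^bsub>class_group S G\<^esub> h = e"
      using grp.inv_closed[of h] grp.r_inv[of h] that by auto
    have "h \<cdot> y \<in> G" using grp.m_closed[of h y] that by simp
    moreover have "(h, h \<cdot> y) \<in> \<sigma>"
      using left[OF that(3,1) e(1)] e_right[OF that(1)] by simp
    ultimately show ?thesis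
      using right[of h "h \<cdot> y", OF _ i(1) that(1)] i grp.m_closed[of "h \<cdot> y" "inv\<^bsub>class_group S G\<^esub> h"]
      by simp
  qed
  ultimately show ?thesis
    by (auto simp: grp.normal_inv_iff)
qed

text \<open>A related pair inside an H-class is transported into \<open>G\<close> by one-sided
  inverses of the factors of \<open>u\<close>, sending \<open>u\<close> to \<open>e\<close>; the
  image of \<open>v\<close> is then the required element of the kernel.\<close>

lemma Cong_restrict_Jcl_eq_nu:
  assumes H: "\<sigma> \<inter> Jcl \<times> Jcl \<subseteq> greenH S"
  shows "\<sigma> \<inter> Jcl \<times> Jcl = nu {y \<in> G. (e, y) \<in> \<sigma>}"
proof
  have eX: "e \<in> X" using e_in G_subset_ideal by auto
  \<comment> \<open>Multipliers for \<open>\<sigma>\<close> must lie in \<open>X\<close>; those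
    normalized at \<open>e\<close> do, being multiples of \<open>e \<in> X\<close>.\<close>
  have in_X: "c \<in> X" if "c \<in> mor" "cd c = dm e \<and> c \<cdot> e = c \<or> dm c = dm e \<and> e \<cdot> c = c" for c
    using that ideal_mult(1)[OF X(1) eX, of c] ideal_mult(2)[OF X(1) eX, of c] by auto
  show "nu {y \<in> G. (e, y) \<in> \<sigma>} \<subseteq> \<sigma> \<inter> Jcl \<times> Jcl"
  proof (rule subrelI)
    fix u v assume uv: "(u, v) \<in> nu {y \<in> G. (e, y) \<in> \<sigma>}"
    then have "u \<in> Jcl" "v \<in> Jcl" using equiv_nu[OF Cong_kernel_normal] by (auto simp: equiv_def)
    moreover obtain c b y where f: "factors c b" and y: "y \<in> G" "(e, y) \<in> \<sigma>"
      and u: "u = c \<cdot> b" and v: "v = c \<cdot> y \<cdot> b"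
      using uv by (auto simp: nu_def)
    have c: "c \<in> mor" "b \<in> mor" "cd c = dm e" "dm b = dm e" "c \<cdot> e = c" "e \<cdot> b = b"
      using f by (auto simp: factors_def)
    have cX: "c \<in> X" "b \<in> X" using in_X c by auto
    have "(c, c \<cdot> y) \<in> \<sigma>" using Cong_left[OF \<sigma> y(2), of c] c cX by simp
    then have "(u, v) \<in> \<sigma>" using Cong_right[OF \<sigma>, of c "c \<cdot> y" b] c cX u v by simp
    ultimately show "(u, v) \<in> \<sigma> \<inter> Jcl \<times> Jcl" by simp
  qed
  show "\<sigma> \<inter> Jcl \<times> Jcl \<subseteq> nu {y \<in> G. (e, y) \<in> \<sigma>}"
  proof (rule subrelI)
    fix u v assume "(u, v) \<in> \<sigma> \<inter> Jcl \<times> Jcl"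
    then have uv: "(u, v) \<in> \<sigma>" "u \<in> Jcl" "v \<in> Jcl" and uvH: "(u, v) \<in> greenH S" using H by auto
    have m: "u \<in> mor" "v \<in> mor" "cd v = cd u" "dm v = dm u"
      using greenH_psim[OF uvH] uvH by (auto simp: greenH_iff psim_def)
    obtain c b where f: "factors c b" and u: "u = c \<cdot> b"
      using J_below_e_factors uv(2) Jcl_iff by blast
    have J: "J_below e (c \<cdot> b)" using uv u Jcl_iff by blast
    have c: "c \<in> mor" "b \<in> mor" "cd c = dm e" "dm b = dm e" "c \<cdot> e = c" "e \<cdot> b = b"
      using f by (auto simp: factors_def)
    obtain b' where b': "b' \<in> mor" "dm b' = cd b" "cd b' = dm e" "b' \<cdot> e = b'" "b \<cdot> b' = e"
      using factors_right_inverse[OF f J] .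
    obtain c' where c': "c' \<in> mor" "dm c' = dm e" "cd c' = dm c" "e \<cdot> c' = c'" "c' \<cdot> c = e"
      using factors_left_inverse[OF f J] .
    define y where "y = c' \<cdot> v \<cdot> b'"
    have dv: "dm v = dm c" "cd v = cd b" using m u c by auto
    note ty = c b' c' m(2) dv
    have "(c' \<cdot> u, c' \<cdot> v) \<in> \<sigma>"
      using Cong_left[OF \<sigma> uv(1), of c'] in_X[of c'] c' u c by simp
    then have "(c' \<cdot> u \<cdot> b', y) \<in> \<sigma>"
      unfolding y_def using Cong_right[OF \<sigma>, of "c' \<cdot> u" "c' \<cdot> v" b'] in_X[of b'] c' b' u c by simp
    moreover have "c' \<cdot> u \<cdot> b' = e"
      using ty mult_assoc[of c' c b] by (simp add: u)
    ultimately have ey: "(e, y) \<in> \<sigma>" by simp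
    \<comment> \<open>\<open>b' \<cdot> b\<close> is a right identity for
      \<open>u = c \<cdot> b\<close>, hence for its left multiple \<open>v\<close>; dually,
      \<open>c \<cdot> c'\<close> is a left identity for \<open>v\<close>. So \<open>v\<close> is
      recovered from \<open>y\<close>.\<close>
    have "v \<cdot> (b' \<cdot> b) = v"
    proof -
      obtain s where s: "s \<in> mor" "cd s = dm u" "v = s \<cdot> u"
        using uvH by (auto simp: greenH_iff elim!: L_belowE[of v u])
      have "u \<cdot> (b' \<cdot> b) = u"
        using ty mult_assoc[of c b "b' \<cdot> b"] mult_assoc[of b b' b] by (simp add: u)
      then show ?thesis using s ty m mult_assoc[of s u "b' \<cdot> b"] by (simp add: u)
    qed
    moreover have "c \<cdot> c' \<cdot> v = v"
    proof -
      obtain s where s: "s \<in> mor" "dm s = cd u" "v = u \<cdot> s"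
        using uvH by (auto simp: greenH_iff elim!: R_belowE[of v u])
      have "c \<cdot> c' \<cdot> u = u"
        using ty mult_assoc[of "c \<cdot> c'" c b] mult_assoc[of c c' c] by (simp add: u)
      then show ?thesis using s ty m mult_assoc[of "c \<cdot> c'" u s] by (simp add: u)
    qed
    moreover have "c \<cdot> y \<cdot> b = c \<cdot> c' \<cdot> v \<cdot> (b' \<cdot> b)"
      unfolding y_def using ty by (simp add: mult_assoc)
    ultimately have v: "v = c \<cdot> y \<cdot> b" by simp
    have y: "y \<in> mor" "dm y = dm e" "cd y = dm e" "y \<cdot> e = y"
      unfolding y_def using ty mult_assoc[of "c' \<cdot> v" b' e] by simp_all
    have ey': "e \<cdot> y = y"
      unfolding y_def using ty mult_assoc[of e "c' \<cdot> v" b'] mult_assoc[of e c' v] by simp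
    \<comment> \<open>\<open>e\<close> is J-below \<open>v\<close> and
      \<open>v = c \<cdot> y \<cdot> b\<close> is J-below \<open>y\<close>, so \<open>y\<close> does
      not drop out of the class of \<open>e\<close>.\<close>
    have "J_below v y"
      unfolding v by (rule J_belowI) (use ty y in auto)
    then have "J_below e y"
      using uv(3) J_below_trans[of y v e] y by (simp add: greenJ_iff)
    then have "y \<in> G" using in_G_I[of y] y ey' by simp
    then show "(u, v) \<in> nu {y \<in> G. (e, y) \<in> \<sigma>}"
      using f u v ey J by (auto simp: nu_def)
  qed
qed

end

end

section \<open>Chains of ideals\<close>

lemma enat_le_trans: "m \<le> n \<Longrightarrow> enat n \<le> r \<Longrightarrow> enat m \<le> r"
  by (meson enat_ord_simps(1) order_trans)

lemma enat_le_less_trans: "m \<le> n \<Longrightarrow> enat n < r \<Longrightarrow> enat m < r"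
  by (meson enat_ord_simps(1) le_less_trans)

locale ideal_chain =
  fixes U :: "('a, 'o) psgp" and \<xi> :: enat and D :: "nat \<Rightarrow> 'a set"
  assumes chain: "chain_of_ideals U \<xi> D"
begin

sublocale stable_regular_partial_semigroup U
  using chain by unfold_locales (auto simp: chain_of_ideals_def)

notation mult (infixl "\<cdot>" 70)

abbreviation I :: "enat \<Rightarrow> 'a set" where "I \<equiv> chain_ideal U D"

section \<open>Classes, their indices, and the ideals they form\<close>

lemma D_in_J_classes: "enat q < \<xi> \<Longrightarrow> D q \<in> J_classes U"
  using chain by (auto simp: chain_of_ideals_def bij_betw_def)

lemma D_eq_class:
  assumes "enat q < \<xi>" "x \<in> D q"
  shows "D q = greenJ U `` {x}"
proof -
  obtain z where "D q = greenJ U `` {z}"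
    using D_in_J_classes[OF assms(1)] by (auto simp: J_classes_def elim: quotientE)
  then show ?thesis
    using assms(2) equiv_class_eq[OF equiv_greenJ, of z x] by simp
qed

lemma D_subset: "enat q < \<xi> \<Longrightarrow> D q \<subseteq> mor"
  using D_in_J_classes equiv_greenJ by (auto simp: J_classes_def greenJ_def elim!: quotientE)

lemma D_nonempty: "enat q < \<xi> \<Longrightarrow> D q \<noteq> {}"
  using D_in_J_classes equiv_greenJ[of U] by (auto simp: J_classes_def dest: in_quotient_imp_non_empty)

lemma D_cover:
  assumes "x \<in> mor"
  obtains q where "enat q < \<xi>" "x \<in> D q"
proof -
  have "greenJ U `` {x} \<in> D ` {q. enat q < \<xi>}"
    using chain quotientI[OF assms, of "greenJ U"]
    by (auto simp: chain_of_ideals_def bij_betw_def J_classes_def)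
  then obtain q where "enat q < \<xi>" "greenJ U `` {x} = D q" by auto
  moreover have "x \<in> greenJ U `` {x}"
    using assms by (simp add: greenJ_iff J_below_refl)
  ultimately show ?thesis using that by auto
qed

text \<open>\<open>J_le\<close> speaks of some representatives, and J-equivalence transfers it to
  the given ones. The chain condition gives the strict comparison, injectivity of \<open>D\<close>
  the case of equal indices.\<close>

lemma J_below_iff_le:
  assumes p: "enat p < \<xi>" "x \<in> D p" and q: "enat q < \<xi>" "y \<in> D q"
  shows "J_below x y \<longleftrightarrow> p \<le> q"
proof -
  have m: "x \<in> mor" "y \<in> mor" using D_subset p q by auto
  have less: "p < q \<longleftrightarrow> J_less U (D p) (D q)"
    using chain p q by (auto simp: chain_of_ideals_def)
  have inj: "D p = D q \<longleftrightarrow> p = q"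
    using chain p(1) q(1) by (auto simp: chain_of_ideals_def bij_betw_def dest: inj_onD)
  have le: "J_le U (D p) (D q) \<longleftrightarrow> J_below x y"
  proof
    assume "J_below x y"
    then show "J_le U (D p) (D q)"
      using p q Inl_in_principal_iff[OF m(2)] by (auto simp: J_le_def)
  next
    assume "J_le U (D p) (D q)"
    then obtain x' y' where xy': "x' \<in> D p" "y' \<in> D q" "Inl x' \<in> principal U y'"
      by (auto simp: J_le_def)
    have m': "x' \<in> mor" "y' \<in> mor" using D_subset p q xy' by auto
    have "J_below x x'" "J_below y' y"
      using D_eq_class[OF p] D_eq_class[OF q] xy'(1,2) by (auto simp: greenJ_iff)
    moreover have "J_below x' y'" using xy'(3) Inl_in_principal_iff[OF m'(2)] by simp
    ultimately show "J_below x y"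
      using J_below_trans[OF m'(2)] J_below_trans[OF m(2)] by blast
  qed
  show ?thesis
    using less inj le J_below_refl[OF m(1)] D_eq_class[OF p] q
    by (auto simp: J_less_def le_less greenJ_iff)
qed

lemma D_disjoint:
  assumes "enat p < \<xi>" "x \<in> D p" "enat q < \<xi>" "x \<in> D q"
  shows "p = q"
  using J_below_iff_le[OF assms] J_below_iff_le[OF assms(3,4,1,2)] J_below_refl D_subset assms
  by (metis le_antisym subsetD)

text \<open>The admissible \<open>r\<close> of the theorem, with \<omega> encoded as
  \<open>\<infinity>\<close>. In both cases \<open>enat m \<le> r\<close> yields a genuine level
  \<open>m\<close> of the chain.\<close>

definition height :: "enat \<Rightarrow> bool" where
  "height r \<longleftrightarrow> r < \<xi> \<or> r = \<infinity> \<and> \<xi> = \<infinity>"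

lemma height_le: "height r \<Longrightarrow> enat m \<le> r \<Longrightarrow> enat m < \<xi>"
  by (auto simp: height_def intro: le_less_trans)

lemma height_enat [simp]: "height (enat m) \<longleftrightarrow> enat m < \<xi>"
  by (simp add: height_def)

text \<open>Makes the finite and infinite cases uniform: for \<open>r = \<infinity>\<close> the
  bound on \<open>m\<close> is vacuous and the classes cover \<open>pmor U\<close>.\<close>

lemma chain_ideal_iff:
  assumes "height r"
  shows "x \<in> I r \<longleftrightarrow> (\<exists>m. enat m \<le> r \<and> x \<in> D m)"
proof (cases r)
  case (enat n)
  then show ?thesis by (auto simp: chain_ideal_def)
next
  case infinity
  then have "\<xi> = \<infinity>" using assms by (simp add: height_def)
  then have "x \<in> mor \<longleftrightarrow> (\<exists>m. x \<in> D m)"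
    using D_cover[of x] D_subset by (metis enat_ord_code(4) subsetD)
  then show ?thesis using infinity by (simp add: chain_ideal_def)
qed

lemma D_subset_I: "height r \<Longrightarrow> enat m \<le> r \<Longrightarrow> D m \<subseteq> I r"
  by (auto simp: chain_ideal_iff)

lemma I_mono: "height r \<Longrightarrow> enat m \<le> r \<Longrightarrow> I (enat m) \<subseteq> I r"
  using height_le[of r m] enat_le_trans[of _ m r] by (fastforce simp: chain_ideal_iff)

lemma D_Int_I:
  assumes "height r" "enat q < \<xi>" "x \<in> D q" "x \<in> I r"
  shows "enat q \<le> r"
proof -
  obtain m where "enat m \<le> r" "x \<in> D m" using assms(1,4) by (auto simp: chain_ideal_iff)
  then show ?thesis using D_disjoint[OF _ _ assms(2,3)] height_le[OF assms(1)] by metis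
qed

lemma I_Suc: "I (enat (Suc m)) = I (enat m) \<union> D (Suc m)"
  by (auto simp: chain_ideal_def atMost_Suc)

lemma ideal_I:
  assumes "height r"
  shows "is_ideal U (I r)"
proof -
  \<comment> \<open>Products are J-below their factors, so being closed downwards suffices for the
    ideal property.\<close>
  have down: "y \<in> I r" if x: "x \<in> I r" and y: "y \<in> mor" "J_below y x" for x y
  proof -
    obtain m where m: "enat m \<le> r" "x \<in> D m" using x chain_ideal_iff[OF assms] by auto
    obtain q where q: "enat q < \<xi>" "y \<in> D q" using D_cover[OF y(1)] .
    have "q \<le> m" using J_below_iff_le[OF q height_le[OF assms m(1)] m(2)] y by simp
    then show ?thesis
      using q m enat_le_trans by (auto simp: chain_ideal_iff[OF assms])
  qed
  have sub: "I r \<subseteq> mor"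
    using D_subset height_le[OF assms] chain_ideal_iff[OF assms] by blast
  have "0 < \<xi>" using chain by (auto simp: chain_of_ideals_def ileI1 zero_less_iff_neq_zero)
  then have "I r \<noteq> {}"
    using D_nonempty[of 0] D_subset_I[OF assms, of 0] by (auto simp: zero_enat_def[symmetric])
  moreover have "(cd s = dm x \<longrightarrow> s \<cdot> x \<in> I r) \<and> (cd x = dm s \<longrightarrow> x \<cdot> s \<in> I r)"
    if "x \<in> I r" "s \<in> mor" for x s
    using that sub down[of x] J_below_mult[of x s] by auto
  ultimately show ?thesis
    unfolding is_ideal_def using sub by blast
qed

section \<open>The top class of a chain ideal\<close>

lemma J_le_psub:
  assumes "is_ideal U X" "B \<subseteq> X"
  shows "J_le (psub U X) A B \<longleftrightarrow> J_le U A B"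
  unfolding J_le_def using assms(2) Inl_in_principal_psub[OF assms(1)] by (meson subsetD)

lemma J_classes_I:
  assumes m: "enat m < \<xi>"
  shows "J_classes (psub U (I (enat m))) = D ` {..m}"
proof -
  have m': "height (enat m)" using m by simp
  have cl: "(greenJ U \<inter> I (enat m) \<times> I (enat m)) `` {x} = D q" if "q \<le> m" "x \<in> D q" for x q
  proof -
    have q: "enat q < \<xi>" using that m enat_le_less_trans by blast
    have "D q \<subseteq> I (enat m)" using D_subset_I[OF m', of q] that by simp
    then show ?thesis using D_eq_class[OF q that(2)] that by auto
  qed
  show ?thesis
    unfolding J_classes_def greenJ_psub[OF ideal_I[OF m']] psub_simps
  proof (intro equalityI subsetI)
    fix A assume "A \<in> I (enat m) // (greenJ U \<inter> I (enat m) \<times> I (enat m))"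
    then obtain x where x: "x \<in> I (enat m)" "A = (greenJ U \<inter> I (enat m) \<times> I (enat m)) `` {x}"
      by (auto elim: quotientE)
    then obtain q where "q \<le> m" "x \<in> D q" by (auto simp: chain_ideal_iff[OF m'])
    then show "A \<in> D ` {..m}" using cl x by auto
  next
    fix A assume "A \<in> D ` {..m}"
    then obtain q where q: "q \<le> m" "A = D q" by auto
    have q': "enat q < \<xi>" using q m enat_le_less_trans by blast
    then obtain x where x: "x \<in> D q" using D_nonempty by auto
    then have "x \<in> I (enat m)" using D_subset_I[OF m', of q] q by auto
    then show "A \<in> I (enat m) // (greenJ U \<inter> I (enat m) \<times> I (enat m))"
      using cl[OF q(1) x] q(2) quotientI by metis
  qed
qed

lemma top_class_I:
  assumes m: "enat m < \<xi>"
  shows "top_class (psub U (I (enat m))) = D m"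
proof -
  have m': "height (enat m)" using m by simp
  have le: "J_le (psub U (I (enat m))) (D p) (D q) \<longleftrightarrow> p \<le> q" if "p \<le> m" "q \<le> m" for p q
  proof -
    have pq: "enat p < \<xi>" "enat q < \<xi>" using that enat_le_less_trans[OF _ m] by auto
    obtain x y where xy: "x \<in> D p" "y \<in> D q" using D_nonempty pq by blast
    have "J_le (psub U (I (enat m))) (D p) (D q) \<longleftrightarrow> J_le U (D p) (D q)"
      using J_le_psub[OF ideal_I[OF m'] D_subset_I[OF m', of q]] that by simp
    also have "\<dots> \<longleftrightarrow> (\<exists>x \<in> D p. \<exists>y \<in> D q. J_below x y)"
      unfolding J_le_def using Inl_in_principal_iff D_subset[OF pq(2)] by (meson subsetD)
    also have "\<dots> \<longleftrightarrow> p \<le> q"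
      using xy J_below_iff_le[OF pq(1) _ pq(2)] by auto
    finally show ?thesis .
  qed
  show ?thesis unfolding top_class_def
  proof (rule the_equality)
    show "is_max_J_class (psub U (I (enat m))) (D m)"
      using le by (auto simp: is_max_J_class_def J_classes_I[OF m])
    fix M assume "is_max_J_class (psub U (I (enat m))) M"
    then obtain q where "q \<le> m" "M = D q" "J_le (psub U (I (enat m))) (D m) (D q)"
      by (auto simp: is_max_J_class_def J_classes_I[OF m])
    then show "M = D m" using le[of m q] by simp
  qed
qed

text \<open>The consequence of \<open>nabla_gen\<close> that is carried up the chain, phrased for
  any congruence containing the pair and with the H-relation of \<open>U\<close> itself.\<close>

definition generates_nabla :: "nat \<Rightarrow> bool" where
  "generates_nabla m \<longleftrightarrow> (\<forall>\<sigma> \<in> Cong (psub U (I (enat m))). \<forall>x \<in> D m. \<forall>y.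
     (x, y) \<in> \<sigma> \<longrightarrow> (x, y) \<notin> greenH U \<longrightarrow> nabla (psub U (I (enat m))) \<subseteq> \<sigma>)"

lemma nabla_gen_generates:
  assumes m: "enat m < \<xi>" and gen: "nabla_gen (psub U (I (enat m)))"
  shows "generates_nabla m"
  unfolding generates_nabla_def
proof (intro ballI allI impI)
  fix \<sigma> x y
  assume \<sigma>: "\<sigma> \<in> Cong (psub U (I (enat m)))" and x: "x \<in> D m"
    and xy: "(x, y) \<in> \<sigma>" "(x, y) \<notin> greenH U"
  have "y \<in> I (enat m)" "psim U x y"
    using Cong_mor[OF \<sigma> xy(1)] Cong_psim[OF \<sigma> xy(1)] by auto
  then have "cong_gen (psub U (I (enat m))) x y = nabla (psub U (I (enat m)))"
    using gen x xy(2) m unfolding nabla_gen_def top_class_I[OF m]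
    by (auto simp: greenH_psub[OF ideal_I])
  then show "nabla (psub U (I (enat m))) \<subseteq> \<sigma>"
    using cong_gen_subset[OF \<sigma> xy(1)] by simp
qed

text \<open>The restriction of \<open>\<sigma>\<close> to \<open>I (enat m)\<close> is a congruence
  there, so the property at level \<open>m\<close> acts inside every larger chain ideal.\<close>

lemma generates_nablaD:
  assumes gen: "generates_nabla m" and m: "enat m < \<xi>" and r: "height r" "enat m \<le> r"
    and \<sigma>: "\<sigma> \<in> Cong (psub U (I r))" and x: "x \<in> D m" and y: "y \<in> I (enat m)"
    and xy: "(x, y) \<in> \<sigma>" "(x, y) \<notin> greenH U"
  shows "nabla (psub U (I (enat m))) \<subseteq> \<sigma>"
proof -
  have c: "\<sigma> \<inter> I (enat m) \<times> I (enat m) \<in> Cong (psub U (I (enat m)))"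
    using Cong_restrict[OF \<sigma> ideal_I I_mono[OF r]] m by simp
  have "x \<in> I (enat m)" using x D_subset_I[of "enat m" m] m by auto
  then have "(x, y) \<in> \<sigma> \<inter> I (enat m) \<times> I (enat m)" using y xy by simp
  from gen[unfolded generates_nabla_def, rule_format, OF c x this xy(2)] show ?thesis by simp
qed

section \<open>Separation and its upward propagation\<close>

context
  fixes m \<sigma>
  assumes sep: "Sep (psub U (I (enat (Suc m))))" and m: "enat (Suc m) < \<xi>"
    and \<sigma>: "\<sigma> \<in> Cong (psub U (I (enat (Suc m))))"
begin

lemma m_less: "enat m < \<xi>"
  using m enat_le_less_trans[of m "Suc m"] by simp

lemma I_Suc_minus_D: "I (enat (Suc m)) - D (Suc m) = I (enat m)"
  using D_Int_I[of "enat m" "Suc m"] m m_less by (auto simp: I_Suc)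

text \<open>Conditions (S1), (S2) and (S3) in this order, for an arbitrary congruence containing the
  given pair.\<close>

lemma Sep_unfolded:
  shows Sep_lower: "x \<in> D (Suc m) \<Longrightarrow> y \<in> I (enat m) \<Longrightarrow> (x, y) \<in> \<sigma> \<Longrightarrow>
      \<exists>x' y'. (x', y') \<in> \<sigma> \<and> x' \<in> D m \<and> y' \<in> I (enat m) \<and> (x', y') \<notin> greenH U"
    and Sep_not_H: "x \<in> D (Suc m) \<Longrightarrow> y \<in> D (Suc m) \<Longrightarrow> (x, y) \<in> \<sigma> \<Longrightarrow> (x, y) \<notin> greenH U \<Longrightarrow>
      \<exists>x' y'. (x', y') \<in> \<sigma> \<and> x' \<in> D (Suc m) \<and> y' \<in> I (enat m)"
    and Sep_H: "x \<in> D (Suc m) \<Longrightarrow> (x, y) \<in> greenH U \<Longrightarrow> x \<noteq> y \<Longrightarrow> (x, y) \<in> \<sigma> \<Longrightarrow>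
      \<exists>x' y'. (x', y') \<in> \<sigma> \<and> x' \<in> D m \<and> y' \<in> I (enat m) \<and> (x', y') \<notin> greenH U"
proof -
  let ?T = "psub U (I (enat (Suc m)))"
  have H: "greenH ?T = greenH U \<inter> I (enat (Suc m)) \<times> I (enat (Suc m))"
    "greenH (psub U (I (enat m))) = greenH U \<inter> I (enat m) \<times> I (enat m)"
    using greenH_psub ideal_I m m_less by auto
  have sub: "D m \<subseteq> I (enat m)" using D_subset_I[of "enat m" m] m_less by auto
  \<comment> \<open>The top class of \<open>I (enat (Suc m))\<close> is \<open>D (Suc m)\<close>,
    what remains is \<open>I (enat m)\<close>, and the top class of that is
    \<open>D m\<close>.\<close>
  note S = sep[unfolded Sep_def Let_def psub_simps top_class_I[OF m] I_Suc_minus_D psub_psub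
      top_class_I[OF m_less] psim_psub]
  have gen: "cong_gen ?T x y \<subseteq> \<sigma>" "psim U x y" "y \<in> I (enat (Suc m))" "x \<in> I (enat (Suc m))"
    if "(x, y) \<in> \<sigma>" for x y
    using cong_gen_subset[OF \<sigma> that] Cong_psim[OF \<sigma> that] Cong_mor[OF \<sigma> that] by auto
  show "\<exists>x' y'. (x', y') \<in> \<sigma> \<and> x' \<in> D m \<and> y' \<in> I (enat m) \<and> (x', y') \<notin> greenH U"
    if a: "x \<in> D (Suc m)" "y \<in> I (enat m)" "(x, y) \<in> \<sigma>"
  proof -
    from S a gen[OF a(3)] obtain p where "p \<in> cong_gen ?T x y"
      "case p of (x', y') \<Rightarrow> x' \<in> D m \<and> y' \<in> I (enat m) - greenH (psub U (I (enat m))) `` {x'}"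
      by blast
    then show ?thesis using gen(1)[OF a(3)] sub H(2) by (cases p) auto
  qed
  show "\<exists>x' y'. (x', y') \<in> \<sigma> \<and> x' \<in> D (Suc m) \<and> y' \<in> I (enat m)"
    if a: "x \<in> D (Suc m)" "y \<in> D (Suc m)" "(x, y) \<in> \<sigma>" "(x, y) \<notin> greenH U"
  proof -
    have "y \<in> D (Suc m) - greenH ?T `` {x}" using a H(1) by auto
    with S a gen[OF a(3)] obtain p where "p \<in> cong_gen ?T x y"
      "case p of (x', y') \<Rightarrow> x' \<in> D (Suc m) \<and> y' \<in> I (enat m)"
      by blast
    then show ?thesis using gen(1)[OF a(3)] by (cases p) auto
  qed
  show "\<exists>x' y'. (x', y') \<in> \<sigma> \<and> x' \<in> D m \<and> y' \<in> I (enat m) \<and> (x', y') \<notin> greenH U"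
    if a: "x \<in> D (Suc m)" "(x, y) \<in> greenH U" "x \<noteq> y" "(x, y) \<in> \<sigma>"
  proof -
    have "y \<in> greenH ?T `` {x} - {x}" using a gen[OF a(4)] H(1) by auto
    with S a obtain p where "p \<in> cong_gen ?T x y"
      "case p of (x', y') \<Rightarrow> x' \<in> D m \<and> y' \<in> I (enat m) - greenH (psub U (I (enat m))) `` {x'}"
      by blast
    then show ?thesis using gen(1)[OF a(4)] sub H(2) by (cases p) auto
  qed
qed

end

lemma generates_nabla_Suc:
  assumes gen: "generates_nabla m" and sep: "Sep (psub U (I (enat (Suc m))))"
    and m: "enat (Suc m) < \<xi>"
  shows "generates_nabla (Suc m)"
  unfolding generates_nabla_def
proof (intro ballI allI impI)
  fix \<sigma> x y
  assume \<sigma>: "\<sigma> \<in> Cong (psub U (I (enat (Suc m))))" and x: "x \<in> D (Suc m)"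
    and xy: "(x, y) \<in> \<sigma>" "(x, y) \<notin> greenH U"
  have m': "enat m < \<xi>" by (rule m_less[OF sep m \<sigma>])
  have hm: "height (enat (Suc m))" using m by simp
  have "y \<in> I (enat m) \<or> y \<in> D (Suc m)"
    using Cong_mor[OF \<sigma> xy(1)] by (auto simp: I_Suc)
  \<comment> \<open>If \<open>y\<close> is already in \<open>I (enat m)\<close> the pair itself
    serves; otherwise (S2) supplies one.\<close>
  then obtain v w where vw: "(v, w) \<in> \<sigma>" "v \<in> D (Suc m)" "w \<in> I (enat m)"
    using x xy Sep_not_H[OF sep m \<sigma> x _ xy] by blast
  obtain x' y' where "(x', y') \<in> \<sigma>" "x' \<in> D m" "y' \<in> I (enat m)" "(x', y') \<notin> greenH U"
    using Sep_lower[OF sep m \<sigma> vw(2,3,1)] by blast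
  then have low: "nabla (psub U (I (enat m))) \<subseteq> \<sigma>"
    using generates_nablaD[OF gen m' hm _ \<sigma>] by simp
  have collapse: "\<exists>z'. (z, z') \<in> \<sigma> \<and> z' \<in> I (enat m)" if z: "z \<in> I (enat (Suc m))" for z
  proof (cases "z \<in> D (Suc m)")
    case True
    then have "J_below z v" using J_below_iff_le[OF m _ m vw(2)] by simp
    then obtain s t where st: "s \<in> mor" "t \<in> mor" "cd s = dm v" "dm t = cd v" "z = s \<cdot> v \<cdot> t"
      by (rule J_belowE)
    have zm: "z \<in> mor" using True D_subset[OF m] by auto
    obtain a where a: "a \<in> mor" "dm a = cd z" "cd a = dm z" "z \<cdot> (a \<cdot> z) = z"
      using regular_elem[OF zm] .
    have vm: "v \<in> mor" using vw(2) D_subset[OF m] by auto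
    \<comment> \<open>The multipliers must lie in the ideal carrying \<open>\<sigma>\<close>, so \<open>s\<close> and \<open>t\<close> are replaced
      by \<open>z \<cdot> a \<cdot> s\<close> and \<open>t \<cdot> a \<cdot> z\<close>.\<close>
    define p q where "p = z \<cdot> (a \<cdot> s)" and "q = t \<cdot> (a \<cdot> z)"
    have dz: "dm z = dm s" "cd z = cd t" using st vm by simp_all
    have pm: "p \<in> mor" "cd p = dm v" and qm: "q \<in> mor" "dm q = cd v"
      unfolding p_def q_def using zm a st dz by simp_all
    have pq: "p \<in> I (enat (Suc m))" "q \<in> I (enat (Suc m))"
      unfolding p_def q_def using zm a st dz z
      by (simp_all add: ideal_mult[OF ideal_I[OF hm]])
    have "p \<cdot> v \<cdot> q = z \<cdot> (a \<cdot> (s \<cdot> v \<cdot> t \<cdot> (a \<cdot> z)))"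
      unfolding p_def q_def using zm a st(1-4) dz vm by (simp add: mult_assoc)
    also have "\<dots> = z" using a by (simp add: st(5)[symmetric])
    finally have pvq: "p \<cdot> v \<cdot> q = z" .
    have w: "w \<in> mor" "dm w = dm v" "cd w = cd v"
      using vw(3) ideal_subset[OF ideal_I, of "enat m"] m' Cong_psim[OF \<sigma> vw(1)]
      by (auto simp: psim_def)
    have "(p \<cdot> v, p \<cdot> w) \<in> \<sigma>" using Cong_left[OF \<sigma> vw(1), of p] pq pm by simp
    then have "(p \<cdot> v \<cdot> q, p \<cdot> w \<cdot> q) \<in> \<sigma>"
      using Cong_right[OF \<sigma>, of "p \<cdot> v" "p \<cdot> w" q] pq pm qm vm by simp
    moreover have "p \<cdot> w \<cdot> q \<in> I (enat m)"
      using ideal_mult[OF ideal_I, of "enat m"] vw(3) w pm qm m' by simp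
    ultimately show ?thesis using pvq by auto
  next
    case False
    then show ?thesis using z Cong_refl[OF \<sigma>] by (auto simp: I_Suc)
  qed
  show "nabla (psub U (I (enat (Suc m)))) \<subseteq> \<sigma>"
  proof (rule subrelI)
    fix z1 z2 assume "(z1, z2) \<in> nabla (psub U (I (enat (Suc m))))"
    then have z: "z1 \<in> I (enat (Suc m))" "z2 \<in> I (enat (Suc m))" "psim U z1 z2" by auto
    obtain w1 w2 where w: "(z1, w1) \<in> \<sigma>" "(z2, w2) \<in> \<sigma>" "w1 \<in> I (enat m)" "w2 \<in> I (enat m)"
      using collapse z by blast
    \<comment> \<open>Congruent elements are parallel, so \<open>w1\<close> and \<open>w2\<close>
      inherit parallelism from \<open>z1\<close> and \<open>z2\<close> and are identified by the
      collapse of \<open>I (enat m)\<close>.\<close>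
    then have "psim U w1 w2"
      using z Cong_psim[OF \<sigma> w(1)] Cong_psim[OF \<sigma> w(2)] by (auto simp: psim_def)
    then have "(w1, w2) \<in> \<sigma>" using w low by auto
    then show "(z1, z2) \<in> \<sigma>"
      using w Cong_sym[OF \<sigma> w(2)] Cong_trans[OF \<sigma>] by meson
  qed
qed

lemma nabla_I_mono:
  "height r \<Longrightarrow> enat m \<le> r \<Longrightarrow> nabla (psub U (I (enat m))) \<subseteq> nabla (psub U (I r))"
  using I_mono[of r m] by auto

text \<open>Intersecting the lift of \<open>\<sigma>\<close> to \<open>U\<close> with
  \<open>I r\<close> gives its lift to \<open>I r\<close>.\<close>

lemma lift_Cong:
  assumes r: "height r" "enat k \<le> r" and \<sigma>: "\<sigma> \<in> Cong (psub U (I (enat k)))"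
    and lift: "liftable U \<sigma>"
  shows "\<sigma> \<union> Id_on (I r) \<in> Cong (psub U (I r))"
proof -
  have U: "psub U (pmor U) = U" by (simp add: psub_def)
  have "\<sigma> \<subseteq> I r \<times> I r"
    using Cong_mor[OF \<sigma>] I_mono[OF r] by auto
  moreover have "I r \<subseteq> mor" using ideal_subset[OF ideal_I[OF r(1)]] .
  ultimately have "(\<sigma> \<union> Id_on mor) \<inter> I r \<times> I r = \<sigma> \<union> Id_on (I r)" by auto
  then show ?thesis
    using Cong_restrict[of "\<sigma> \<union> Id_on mor" U mor, OF _ ideal_I[OF r(1)]] lift \<open>I r \<subseteq> mor\<close>
    by (simp add: liftable_def U)
qed

lemma Rees_normal_Cong_I:
  assumes r: "height r" "enat q < r" and G: "group_H_class U G" "G \<subseteq> D (Suc q)"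
    and N: "N \<lhd> class_group U G"
  shows "Rees_normal_cong (psub U (I r)) (I (enat q)) (D (Suc q)) N \<in> Cong (psub U (I r))"
proof -
  interpret grp: H_class_group U G
    using G by unfold_locales
  \<comment> \<open>A strict bound on \<open>q\<close> is a weak bound on its successor, for finite
    \<open>r\<close> and for \<open>\<infinity>\<close> alike; hence the class
    \<open>D (Suc q)\<close> lies in \<open>I r\<close>.\<close>
  have Suc_q: "enat (Suc q) \<le> r" using r by (simp add: Suc_ile_eq)
  have q: "enat q \<le> r" using r by simp
  have S: "enat (Suc q) < \<xi>" "enat q < \<xi>" using height_le[OF r(1)] Suc_q q by auto
  have D: "D (Suc q) = grp.Jcl"
    using D_eq_class[OF S(1)] grp.e_in G(2) by blast
  have "I (enat q) \<inter> D (Suc q) = {}"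
    using D_Int_I[of "enat q" "Suc q"] S by auto
  moreover have "is_ideal U (I (enat q))" "is_ideal U (I (enat q) \<union> D (Suc q))"
    using ideal_I[of "enat q"] ideal_I[of "enat (Suc q)"] S by (auto simp: I_Suc)
  moreover have "I (enat q) \<union> D (Suc q) \<subseteq> I r"
    using I_mono[OF r(1) Suc_q] by (simp add: I_Suc)
  ultimately show ?thesis
    using grp.Rees_normal_Cong[OF N _ _ _ ideal_I[OF r(1)], of "I (enat q)"] by (simp only: D)
qed

section \<open>Classification of a single congruence\<close>

context
  fixes k :: nat and r :: enat and \<sigma> :: "'a rel"
  assumes gen: "\<And>m. k \<le> m \<Longrightarrow> enat m < \<xi> \<Longrightarrow> generates_nabla m"
    and sep: "\<And>m. k < m \<Longrightarrow> enat m < \<xi> \<Longrightarrow> Sep (psub U (I (enat m)))"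
    and r: "height r" "enat k \<le> r"
    and \<sigma>: "\<sigma> \<in> Cong (psub U (I r))"
begin

text \<open>A pair outside H collapses its own level. A non-trivial pair inside an H-class is sent
  by (S3) to a pair outside H headed in the class below, and so collapses the level below.\<close>

lemma nabla_below_pair:
  assumes m: "k < m" "enat m \<le> r" and xy: "x \<in> D m" "y \<in> I (enat m)" "(x, y) \<in> \<sigma>" "x \<noteq> y"
  shows "nabla (psub U (I (enat m))) \<subseteq> \<sigma> \<or>
    (x, y) \<in> greenH U \<and> nabla (psub U (I (enat (m - 1)))) \<subseteq> \<sigma>"
proof (cases "(x, y) \<in> greenH U")
  case False
  then show ?thesis
    using generates_nablaD[OF gen height_le[OF r(1) m(2)] r(1) m(2) \<sigma> xy(1-3)] m height_le[OF r(1) m(2)]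
    by simp
next
  case True
  obtain n where n: "m = Suc n" using m by (cases m) auto
  have le: "enat n \<le> r" "enat (Suc n) < \<xi>" "k \<le> n"
    using m enat_le_trans[of n m r] height_le[OF r(1) m(2)] n by auto
  have sub: "I (enat (Suc n)) \<subseteq> I r" using I_mono[OF r(1) m(2)] n by simp
  have c: "\<sigma> \<inter> I (enat (Suc n)) \<times> I (enat (Suc n)) \<in> Cong (psub U (I (enat (Suc n))))"
    using Cong_restrict[OF \<sigma> ideal_I sub] le by simp
  have "x \<in> I (enat (Suc n))" using xy(1) by (simp add: n I_Suc)
  then have "(x, y) \<in> \<sigma> \<inter> I (enat (Suc n)) \<times> I (enat (Suc n))" using xy n by simp
  then obtain x' y' where "(x', y') \<in> \<sigma>" "x' \<in> D n" "y' \<in> I (enat n)" "(x', y') \<notin> greenH U"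
    using Sep_H[OF sep le(2) c _ True xy(4)] xy(1) m n le by auto
  then have "nabla (psub U (I (enat n))) \<subseteq> \<sigma>"
    using generates_nablaD[OF gen height_le[OF r(1) le(1)] r(1) le(1) \<sigma>] le height_le[OF r(1) le(1)]
    by simp
  then show ?thesis using True n by simp
qed

lemma nabla_downward:
  assumes "n \<le> m" "enat m \<le> r" "nabla (psub U (I (enat m))) \<subseteq> \<sigma>"
  shows "nabla (psub U (I (enat n))) \<subseteq> \<sigma>"
  using nabla_I_mono[of "enat m" n] assms height_le[OF r(1) assms(2)] by auto

text \<open>Collapse passes downwards, so no level from \<open>n\<close> on is collapsed. A
  non-trivial pair at level \<open>m > n\<close> would collapse \<open>m\<close> or
  \<open>m - 1\<close>, both at least \<open>n\<close>; at \<open>m = n\<close> only the second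
  alternative survives.\<close>

lemma pair_confined:
  assumes n: "k \<le> n" "enat n \<le> r" "\<not> nabla (psub U (I (enat n))) \<subseteq> \<sigma>"
    and m: "k < m" "enat m \<le> r" and xy: "x \<in> D m" "y \<in> I (enat m)" "(x, y) \<in> \<sigma>" "x \<noteq> y"
  shows "m < n \<or> m = n \<and> (x, y) \<in> greenH U \<and> nabla (psub U (I (enat (n - 1)))) \<subseteq> \<sigma>"
proof -
  have "\<not> nabla (psub U (I (enat m'))) \<subseteq> \<sigma>" if "n \<le> m'" "enat m' \<le> r" for m'
    using nabla_downward[OF that] n by blast
  moreover have "enat (m - 1) \<le> r" using enat_le_trans[of "m - 1" m r] m by simp
  ultimately show ?thesis
    using nabla_below_pair[OF m xy] m(2) by (cases "m < n"; cases "m = n") auto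
qed

text \<open>Supplies the orientation that the preceding lemmas expect, with the element of higher
  level first.\<close>

lemma pair_levels:
  assumes "(x, y) \<in> \<sigma>"
  shows "(\<exists>m. enat m \<le> r \<and> x \<in> D m \<and> y \<in> I (enat m)) \<or>
    (\<exists>m. enat m \<le> r \<and> y \<in> D m \<and> x \<in> I (enat m))"
proof -
  obtain p q where pq: "enat p \<le> r" "x \<in> D p" "enat q \<le> r" "y \<in> D q"
    using Cong_mor[OF \<sigma> assms] chain_ideal_iff[OF r(1)] by auto
  have "height (enat p)" "height (enat q)" using height_le[OF r(1)] pq by auto
  then show ?thesis
    using pq D_subset_I[of "enat p" q] D_subset_I[of "enat q" p] nat_le_linear[of p q]
    by (metis enat_ord_simps(1) subsetD)
qed

lemma Cong_cases:
  obtains (lifted) "\<sigma> = \<sigma> \<inter> I (enat k) \<times> I (enat k) \<union> Id_on (I r)"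
  | (nabla) "\<sigma> = nabla (psub U (I r))"
  | (Rees) q where "k \<le> q" "enat q < r"
      "\<sigma> = nabla (psub U (I (enat q))) \<union> Id_on (I r) \<union> (\<sigma> \<inter> D (Suc q) \<times> D (Suc q))"
      "\<sigma> \<inter> D (Suc q) \<times> D (Suc q) \<subseteq> greenH U"
proof -
  let ?full = "\<lambda>m. nabla (psub U (I (enat m))) \<subseteq> \<sigma>"
  have Id: "Id_on (I r) \<subseteq> \<sigma>" using Cong_refl[OF \<sigma>] by auto
  consider "\<not> ?full k" | "\<And>m. k \<le> m \<Longrightarrow> enat m \<le> r \<Longrightarrow> ?full m"
    | m where "k \<le> m" "enat m \<le> r" "\<not> ?full m" "?full k"
    by blast
  then show ?thesis
  proof cases
    case 1
    \<comment> \<open>With \<open>n = k\<close>, \<open>pair_confined\<close> contradicts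
      \<open>k < m\<close>, so every non-trivial pair lies in \<open>I (enat k)\<close>.\<close>
    have low: "x \<in> I (enat k) \<and> y \<in> I (enat k)"
      if "(x, y) \<in> \<sigma>" "x \<noteq> y" "enat m \<le> r" "x \<in> D m" "y \<in> I (enat m)" for x y m
    proof (cases "k < m")
      case True
      then show ?thesis using pair_confined[OF order_refl r(2) 1 True that(3-5,1,2)] by simp
    next
      case False
      then have "I (enat m) \<subseteq> I (enat k)" "D m \<subseteq> I (enat k)"
        using I_mono[of "enat k" m] D_subset_I[of "enat k" m] height_le[OF r] by auto
      then show ?thesis using that by auto
    qed
    have "\<sigma> \<subseteq> \<sigma> \<inter> I (enat k) \<times> I (enat k) \<union> Id_on (I r)"
    proof (rule subrelI)
      fix x y assume xy: "(x, y) \<in> \<sigma>"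
      show "(x, y) \<in> \<sigma> \<inter> I (enat k) \<times> I (enat k) \<union> Id_on (I r)"
      proof (cases "x = y")
        case True
        then show ?thesis using Cong_mor[OF \<sigma> xy] by auto
      next
        case False
        then have "x \<in> I (enat k) \<and> y \<in> I (enat k)"
          using pair_levels[OF xy] low[OF xy] low[OF Cong_sym[OF \<sigma> xy]] by blast
        then show ?thesis using xy by simp
      qed
    qed
    then show ?thesis using lifted Id by blast
  next
    case 2
    have "nabla (psub U (I r)) \<subseteq> \<sigma>"
    proof (rule subrelI)
      fix x y assume xy: "(x, y) \<in> nabla (psub U (I r))"
      then obtain p q where pq: "enat p \<le> r" "x \<in> D p" "enat q \<le> r" "y \<in> D q"
        using chain_ideal_iff[OF r(1)] by auto
      \<comment> \<open>One finite level containing both elements, and at least \<open>k\<close> so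
        that it is known to be collapsed.\<close>
      define m where "m = max k (max p q)"
      have m: "k \<le> m" "p \<le> m" "q \<le> m" "enat m \<le> r" using pq r(2) by (auto simp: m_def max_def)
      then have "x \<in> I (enat m)" "y \<in> I (enat m)"
        using D_subset_I[of "enat m"] height_le[OF r(1) m(4)] pq by auto
      then show "(x, y) \<in> \<sigma>" using 2[OF m(1,4)] xy by auto
    qed
    then show ?thesis using nabla Cong_subset_nabla[OF \<sigma>] by blast
  next
    case 3
    \<comment> \<open>The least uncollapsed level from \<open>k\<close> on. It differs from
      \<open>k\<close>, so its predecessor \<open>q\<close> is at least \<open>k\<close> and, by
      minimality, collapsed.\<close>
    define n where "n = (LEAST m. k \<le> m \<and> \<not> ?full m)"
    have n: "k \<le> n" "\<not> ?full n"
      unfolding n_def using LeastI[of "\<lambda>m. k \<le> m \<and> \<not> ?full m" m] 3 by auto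
    have "n \<le> m" unfolding n_def using Least_le[of "\<lambda>m. k \<le> m \<and> \<not> ?full m" m] 3 by auto
    then have nr: "enat n \<le> r" using enat_le_trans 3 by blast
    have "n \<noteq> k" using n 3 by auto
    then obtain q where q: "n = Suc q" "k \<le> q" using n(1) by (cases n) auto
    have full: "?full q"
      using not_less_Least[of q "\<lambda>m. k \<le> m \<and> \<not> ?full m"] q by (auto simp: n_def)
    have qr: "enat q < r" using nr q by (simp add: Suc_ile_eq)
    have hq: "height (enat q)" using height_le[OF r(1), of q] qr by simp
    \<comment> \<open>Above \<open>q\<close>, \<open>pair_confined\<close> leaves only level
      \<open>Suc q\<close> and H-related pairs; H-related elements share their J-class, so the
      second element is in \<open>D (Suc q)\<close> too.\<close>
    have low: "x \<in> I (enat q) \<and> y \<in> I (enat q) \<or> x \<in> D (Suc q) \<and> y \<in> D (Suc q) \<and> (x, y) \<in> greenH U"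
      if a: "(x, y) \<in> \<sigma>" "x \<noteq> y" "enat m \<le> r" "x \<in> D m" "y \<in> I (enat m)" for x y m
    proof (cases "m \<le> q")
      case True
      then have "I (enat m) \<subseteq> I (enat q)" "D m \<subseteq> I (enat q)"
        using I_mono[OF hq] D_subset_I[OF hq] by auto
      then show ?thesis using a by auto
    next
      case False
      then have "m = Suc q" "(x, y) \<in> greenH U"
        using pair_confined[OF n(1) nr n(2) _ a(3-5,1,2)] q by auto
      then show ?thesis
        using a greenH_imp_greenJ[of x y] D_eq_class[of "Suc q" x] height_le[OF r(1) a(3)] by auto
    qed
    have "\<sigma> \<subseteq> nabla (psub U (I (enat q))) \<union> Id_on (I r) \<union> (\<sigma> \<inter> D (Suc q) \<times> D (Suc q))"
    proof (rule subrelI)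
      fix x y assume xy: "(x, y) \<in> \<sigma>"
      show "(x, y) \<in> nabla (psub U (I (enat q))) \<union> Id_on (I r) \<union> (\<sigma> \<inter> D (Suc q) \<times> D (Suc q))"
      proof (cases "x = y")
        case True
        then show ?thesis using Cong_mor[OF \<sigma> xy] by auto
      next
        case False
        then have "x \<in> I (enat q) \<and> y \<in> I (enat q) \<or> x \<in> D (Suc q) \<and> y \<in> D (Suc q)"
          using pair_levels[OF xy] low[OF xy] low[OF Cong_sym[OF \<sigma> xy]] by blast
        then show ?thesis using xy Cong_psim[OF \<sigma> xy] by auto
      qed
    qed
    moreover have "\<sigma> \<inter> D (Suc q) \<times> D (Suc q) \<subseteq> greenH U"
    proof (rule subrelI)
      fix x y assume xy: "(x, y) \<in> \<sigma> \<inter> D (Suc q) \<times> D (Suc q)"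
      have S: "enat (Suc q) < \<xi>" using height_le[OF r(1) nr] q by simp
      have "x \<in> mor" using xy D_subset[OF S] by auto
      then have "(x, x) \<in> greenH U" using equiv_greenH by (auto simp: equiv_def refl_on_def)
      moreover have "y \<in> I (enat (Suc q))" using xy by (simp add: I_Suc)
      ultimately show "(x, y) \<in> greenH U"
        using pair_confined[OF n(1) nr n(2), of n x y] nr q xy by (cases "x = y") auto
    qed
    ultimately show ?thesis using Rees[OF q(2) qr] full Id by blast
  qed
qed

text \<open>The part of \<open>\<sigma>\<close> on \<open>D (Suc q)\<close> lies in H, so it is
  \<open>nu\<close> of the kernel of \<open>\<sigma>\<close> on \<open>G\<close>; the rest of
  \<open>eq\<close> is already the Rees congruence of \<open>I (enat q)\<close>.\<close>

lemma Cong_eq_Rees_normal: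
  assumes q: "enat q < r" and G: "group_H_class U G" "G \<subseteq> D (Suc q)"
    and eq: "\<sigma> = nabla (psub U (I (enat q))) \<union> Id_on (I r) \<union> (\<sigma> \<inter> D (Suc q) \<times> D (Suc q))"
    and H: "\<sigma> \<inter> D (Suc q) \<times> D (Suc q) \<subseteq> greenH U"
  obtains N where "N \<lhd> class_group U G"
    "\<sigma> = Rees_normal_cong (psub U (I r)) (I (enat q)) (D (Suc q)) N"
proof -
  interpret grp: H_class_group U G
    using G by unfold_locales
  have Suc_q: "enat (Suc q) \<le> r" using q by (simp add: Suc_ile_eq)
  have D: "D (Suc q) = grp.Jcl"
    using D_eq_class[OF height_le[OF r(1) Suc_q]] grp.e_in G(2) by blast
  have sub: "grp.Jcl \<subseteq> I r" using D_subset_I[OF r(1) Suc_q] D by simp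
  define N where "N = {y \<in> G. (grp.e, y) \<in> \<sigma>}"
  have N: "N \<lhd> class_group U G"
    unfolding N_def by (rule grp.Cong_kernel_normal[OF ideal_I[OF r(1)] sub \<sigma>])
  have "\<sigma> \<inter> grp.Jcl \<times> grp.Jcl = grp.nu N"
    unfolding N_def using grp.Cong_restrict_Jcl_eq_nu[OF ideal_I[OF r(1)] sub \<sigma>] H D by simp
  moreover have "nu_rel (psub U (I r)) grp.Jcl N = grp.nu N"
    using grp.nu_rel_eq_nu[OF N ideal_I[OF r(1)]] sub grp.e_Jcl by blast
  ultimately have "\<sigma> = Rees_normal_cong (psub U (I r)) (I (enat q)) (D (Suc q)) N"
    using eq by (simp add: Rees_normal_cong_def Rees_cong_def D)
  then show ?thesis using that N by blast
qed

lemma Cong_classification: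
  assumes G: "\<And>q. enat q < r \<Longrightarrow> group_H_class U (G (Suc q)) \<and> G (Suc q) \<subseteq> D (Suc q)"
  shows "(\<exists>\<tau>. \<sigma> = \<tau> \<union> Id_on (I r) \<and> \<tau> \<in> Cong (psub U (I (enat k)))) \<or>
    (\<exists>q N. \<sigma> = Rees_normal_cong (psub U (I r)) (I (enat q)) (D (Suc q)) N \<and>
      k \<le> q \<and> enat q < r \<and> N \<lhd> class_group U (G (Suc q))) \<or>
    \<sigma> = nabla (psub U (I r))"
proof (cases rule: Cong_cases)
  case lifted
  have "\<sigma> \<inter> I (enat k) \<times> I (enat k) \<in> Cong (psub U (I (enat k)))"
    using Cong_restrict[OF \<sigma> ideal_I I_mono[OF r]] height_le[OF r] by simp
  then show ?thesis using lifted by metis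
next
  case nabla
  then show ?thesis by simp
next
  case (Rees q)
  obtain N where "N \<lhd> class_group U (G (Suc q))"
    "\<sigma> = Rees_normal_cong (psub U (I r)) (I (enat q)) (D (Suc q)) N"
    using Cong_eq_Rees_normal[OF Rees(2) _ _ Rees(3,4)] G[OF Rees(2)] by blast
  then show ?thesis using Rees(1,2) by metis
qed

end

end

theorem theorem4p2:
  fixes U :: "('a, 'o) psgp" and \<xi> :: enat and D G :: "nat \<Rightarrow> 'a set" and k :: nat and r :: enat
  assumes chain: "chain_of_ideals U \<xi> D"
    and G: "\<And>q. enat q < \<xi> \<Longrightarrow> group_H_class U (G q) \<and> G q \<subseteq> D q"
    and k: "enat k < \<xi>"
    and lift: "liftable_Cong U (chain_ideal U D (enat k)) = Cong (psub U (chain_ideal U D (enat k)))"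
    and gen: "nabla_gen (psub U (chain_ideal U D (enat k)))"
    and sep: "\<And>m. k < m \<Longrightarrow> enat m < \<xi> \<Longrightarrow> Sep (psub U (chain_ideal U D (enat m)))"
    and r: "enat k \<le> r" "r < \<xi> \<or> (r = \<infinity> \<and> \<xi> = \<infinity>)"
  shows "Cong (psub U (chain_ideal U D r)) =
      {\<sigma> \<union> Id_on (chain_ideal U D r) | \<sigma>. \<sigma> \<in> Cong (psub U (chain_ideal U D (enat k)))}
    \<union> {Rees_normal_cong (psub U (chain_ideal U D r)) (chain_ideal U D (enat q)) (D (Suc q)) N | q N.
         k \<le> q \<and> enat q < r \<and> N \<lhd> class_group U (G (Suc q))}
    \<union> {nabla (psub U (chain_ideal U D r))}"
proof -
  interpret ideal_chain U \<xi> D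
    using chain by unfold_locales
  have hr: "height r" using r(2) by (simp add: height_def)
  have G': "group_H_class U (G (Suc q))" "G (Suc q) \<subseteq> D (Suc q)" if "enat q < r" for q
    using G[of "Suc q"] height_le[OF hr, of "Suc q"] that by (auto simp: Suc_ile_eq)
  \<comment> \<open>The hypothesis at level \<open>k\<close> starts the induction; separation at
    \<open>Suc m\<close> carries it one level up.\<close>
  have gens: "generates_nabla m" if "k \<le> m" "enat m < \<xi>" for m
    using that
  proof (induction m rule: dec_induct)
    case base
    then show ?case using nabla_gen_generates gen by blast
  next
    case (step m)
    then show ?case
      using generates_nabla_Suc[of m] sep[of "Suc m"] enat_le_less_trans[of m "Suc m" \<xi>] by simp
  qed
  show ?thesis
  proof (intro equalityI subsetI)
    fix \<sigma> assume \<sigma>: "\<sigma> \<in> Cong (psub U (I r))"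
    have "(\<exists>\<tau>. \<sigma> = \<tau> \<union> Id_on (I r) \<and> \<tau> \<in> Cong (psub U (I (enat k)))) \<or>
      (\<exists>q N. \<sigma> = Rees_normal_cong (psub U (I r)) (I (enat q)) (D (Suc q)) N \<and>
        k \<le> q \<and> enat q < r \<and> N \<lhd> class_group U (G (Suc q))) \<or>
      \<sigma> = nabla (psub U (I r))"
      by (rule Cong_classification[OF gens sep hr r(1) \<sigma> conjI[OF G']])
    then show "\<sigma> \<in> {\<sigma> \<union> Id_on (I r) | \<sigma>. \<sigma> \<in> Cong (psub U (I (enat k)))}
      \<union> {Rees_normal_cong (psub U (I r)) (I (enat q)) (D (Suc q)) N | q N.
           k \<le> q \<and> enat q < r \<and> N \<lhd> class_group U (G (Suc q))}
      \<union> {nabla (psub U (I r))}"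
      by (simp only: Un_iff mem_Collect_eq singleton_iff disj_assoc)
  next
    fix \<sigma> assume "\<sigma> \<in> {\<sigma> \<union> Id_on (I r) | \<sigma>. \<sigma> \<in> Cong (psub U (I (enat k)))}
      \<union> {Rees_normal_cong (psub U (I r)) (I (enat q)) (D (Suc q)) N | q N.
           k \<le> q \<and> enat q < r \<and> N \<lhd> class_group U (G (Suc q))}
      \<union> {nabla (psub U (I r))}"
    then consider \<tau> where "\<sigma> = \<tau> \<union> Id_on (I r)" "\<tau> \<in> Cong (psub U (I (enat k)))"
      | q N where "\<sigma> = Rees_normal_cong (psub U (I r)) (I (enat q)) (D (Suc q)) N"
          "enat q < r" "N \<lhd> class_group U (G (Suc q))"
      | "\<sigma> = nabla (psub U (I r))"
      by blast
    then show "\<sigma> \<in> Cong (psub U (I r))"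
    proof cases
      case 1
      \<comment> \<open>Equality of the liftable congruences with all congruences on
        \<open>I (enat k)\<close> is exactly what this family requires.\<close>
      then have "liftable U \<tau>" using lift by (auto simp: liftable_Cong_def)
      then show ?thesis using lift_Cong[OF hr r(1) 1(2)] 1(1) by simp
    next
      case 2
      then show ?thesis using Rees_normal_Cong_I[OF hr 2(2) G'[OF 2(2)] 2(3)] by simp
    next
      case 3
      then show ?thesis
        using nabla_Cong[OF partial_semigroup_psub[OF psg ideal_I[OF hr]]] by simp
    qed
  qed
qed

end
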